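(* Let $\hat\gamma\in\Omega_2$ and let $\gamma=d_H\hat\gamma\in\Omega_1$ be the corresponding solenoidal form. Then every aromatic vector field $\tau\in\Omega_1$ is a divergence symmetry for $\gamma$, i.e. $\mathcal{L}_\tau\gamma\in d_H(\Omega_2)$. Moreover, $\tau\in\Omega_1$ is a divergence symmetry of $\hat\gamma$, i.e. $\mathcal{L}_\tau\hat\gamma\in d_H(\Omega_3)$ (and thus $\tau$ is a symmetry of $\gamma$, i.e. $\mathcal{L}_\tau\gamma=0$), if and only if there exists an aromatic form $\eta\in\Omega_3$ such that $H_\tau\gamma=d_H\eta$.
   Context: Aromatic forests. Consider finite directed graphs with node set $V=V^\bullet\sqcup V^\circ$ (vertices $V^\bullet$, covertices $V^\circ$) and oriented edges $E\subset V\times V$ (loops allowed). Covertices are numbered $1,\dots,p$; vertices are indistinguishable. Each node is the source of exactly one edge, except $n$ nodes (the roots), which have no outgoing edge and are numbered $1,\dots,n$ (the $n$-th root is written $r_n$). A connected component has either exactly one root (a tree) or no root (an aroma). Such graphs, up to isomorphism preserving vertices/covertices and the numberings of covertices and roots, are called aromatic forests; $\mathcal{F}_{n,p}$ is the set of those with $n$ roots and $p$ covertices, and $\mathcal{F}_n=\mathcal{F}_{n,0}$. A predecessor of $u$ is a node $v$ with $(v,u)\in E$. $\mathrm{Span}$ denotes the real span. Aromatic forms. For $\gamma\in\mathcal{F}_{n,p}$ let $\wedge^\bullet\gamma=\frac{1}{n!}\sum_{\sigma\in S_n}\varepsilon(\sigma)\,\sigma\gamma$ with $\sigma$ permuting the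 root numbering, $\wedge^\circ\gamma=\frac1{p!}\sum_{\sigma\in S_p}\varepsilon(\sigma)\,\sigma\gamma$ with $\sigma$ permuting the covertex numbering ($\varepsilon$ is the signature), and $\wedge=\wedge^\bullet\wedge^\circ$, extended linearly. Set $\Omega_{n,p}=\wedge\,\mathrm{Span}(\mathcal{F}_{n,p})$ and $\Omega_n=\Omega_{n,0}$; thus $\Omega_1=\mathrm{Span}(\mathcal{F}_1)$ (aromatic vector fields). Derivatives. For a root $r$ and a node $u$ of $\gamma$ (possibly $u=r$), $D^{r\to u}\gamma$ is $\gamma$ with the edge $(r,u)$ added (so $r$ is no longer a root), and $D^r\gamma=\sum_{u\in V}D^{r\to u}\gamma$. For $v\in V^\bullet$, $\gamma_{v\to k}$ is $\gamma$ with the vertex $v$ replaced by a new covertex numbered $k$. For $\gamma\in\mathcal{F}_{n,p}$ define, and extend linearly, $d_H\gamma=D^{r_n}\gamma$, $d_V\gamma=\wedge\sum_{v\in V^\bullet}\gamma_{v\to p+1}$, $d\gamma=(-1)^{n+p}d_H\gamma+d_V\gamma$. This gives $d_H:\Omega_{n,p}\to\Omega_{n-1,p}$ (with $d_H=0$ on $\Omega_{0,p}$) and $d_V:\Omega_{n,p}\to\Omega_{n,p+1}$. One has $d_H^2=0$. Contraction and Lie derivative. For $\tau\in\mathcal{F}_1$, $\gamma_{k\to\tau}$ is the sum of all forests obtained by replacing covertex $k$ by $\tau$: the root of $\tau$ inherits the outgoing edge of $k$ (or its root number if $k$ is a root), and the predecessors of $k$ are grafted onto the nodes of $\tau$ in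 all possible ways. The contraction is $i_\tau\gamma=p\,\gamma_{p\to\tau}$ for $\gamma\in\mathcal{F}_{n,p}$ (and $i_\tau\gamma=0$ if $p=0$), extended bilinearly to $i_\tau:\Omega_{n,p}\to\Omega_{n,p-1}$, $\tau\in\Omega_1$. The aromatic Lie derivative is $\mathcal{L}_\tau\gamma=(d\,i_\tau+i_\tau d)\gamma$ for $\gamma\in\Omega_{n,p}$, $\tau\in\Omega_1$. Homotopy operators. The horizontal sequences of the aromatic bicomplex are exact (a known result): there exist linear homotopy operators $h_H:\Omega_{n,p}\to\Omega_{n+1,p}$ such that $\gamma=(d_Hh_H+h_Hd_H)\gamma$ for all $\gamma\in\Omega_{n,p}$, $n\ge1$, $p\ge0$. Fix such operators. The Lie homotopy operator is $H_\tau=\mathcal{L}_\tau h_H$ (i.e. $\mathcal{L}_\tau\circ h_H$). Symmetries. $\tau\in\Omega_1$ is a symmetry for an aromatic form $\gamma$ if $\mathcal{L}_\tau\gamma=0$, and a divergence symmetry for $\gamma$ if there is an aromatic form $\eta$ with $\mathcal{L}_\tau\gamma=d_H\eta$. An aromatic vector field $\tau\in\Omega_1$ is solenoidal if it is a symmetry for the aromatic Lagrangian consisting of one vertex with a loop on itself, equivalently $d_H\tau=0$; by exactness the solenoidal forms are exactly the elements of $d_H(\Omega_2)$. *)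

theory Defs
  imports
    "HOL-Analysis.Finite_Function_Topology"
    "HOL-Combinatorics.Permutations"
begin

section \<open>Aromatic forests\<close>

text \<open>
  Covertices and roots are stored as lists whose positions give their numbers:
  the covertex (root) numbered \<open>k\<close> is the entry at position \<open>k - 1\<close>.
\<close>

record 'a agraph =
  vertices :: "'a set"
  edges :: "('a \<times> 'a) set"
  covertices :: "'a list"
  roots :: "'a list"

definition nodes :: "'a agraph \<Rightarrow> 'a set" where
  "nodes g = vertices g \<union> set (covertices g)"

text \<open>
  A component of a finite graph in which every node has at most one outgoing edge has at most
  one node without outgoing edge, so the dichotomy trees/aromas need not be imposed.
\<close>

definition aromatic :: "'a agraph \<Rightarrow> bool" where
  "aromatic g \<longleftrightarrow>
     finite (vertices g) \<and> distinct (covertices g) \<and> vertices g \<inter> set (covertices g) = {} \<and>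
     edges g \<subseteq> nodes g \<times> nodes g \<and>
     distinct (roots g) \<and> set (roots g) \<subseteq> nodes g \<and>
     (\<forall>u\<in>set (roots g). \<forall>w. (u, w) \<notin> edges g) \<and>
     (\<forall>u\<in>nodes g - set (roots g). \<exists>!w. (u, w) \<in> edges g)"

definition relabel :: "('a \<Rightarrow> 'b) \<Rightarrow> 'a agraph \<Rightarrow> 'b agraph" where
  "relabel f g = \<lparr>vertices = f ` vertices g, edges = map_prod f f ` edges g,
                  covertices = map f (covertices g), roots = map f (roots g)\<rparr>"

definition isomorphic :: "'a agraph \<Rightarrow> 'b agraph \<Rightarrow> bool" where
  "isomorphic g h \<longleftrightarrow> (\<exists>f. inj_on f (nodes g) \<and> h = relabel f g)"

lemma relabel_simps [simp]:
  "vertices (relabel f g) = f ` vertices g"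
  "edges (relabel f g) = map_prod f f ` edges g"
  "covertices (relabel f g) = map f (covertices g)"
  "roots (relabel f g) = map f (roots g)"
  "nodes (relabel f g) = f ` nodes g"
  by (auto simp: relabel_def nodes_def)

lemma aromatic_edgeD: "aromatic g \<Longrightarrow> (u, w) \<in> edges g \<Longrightarrow> u \<in> nodes g \<and> w \<in> nodes g"
  by (auto simp: aromatic_def)

lemma aromatic_finite: "aromatic g \<Longrightarrow> finite (nodes g)"
  by (auto simp: aromatic_def nodes_def)

lemma relabel_cong:
  assumes "aromatic g" "\<And>u. u \<in> nodes g \<Longrightarrow> f u = f' u"
  shows "relabel f g = relabel f' g"
proof -
  have "map_prod f f ` edges g = map_prod f' f' ` edges g"
  proof (rule image_cong[OF refl])
    fix e assume "e \<in> edges g"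
    then show "map_prod f f e = map_prod f' f' e"
      using assms aromatic_edgeD[of g "fst e" "snd e"] by (cases e) auto
  qed
  moreover have "set (roots g) \<subseteq> nodes g" using assms(1) by (auto simp: aromatic_def)
  ultimately show ?thesis
    unfolding relabel_def using assms(2) by (auto simp: nodes_def intro!: image_cong)
qed

lemma relabel_comp: "relabel f (relabel f' g) = relabel (f \<circ> f') g"
  by (auto simp: relabel_def image_comp prod.map_comp map_prod.comp)

lemma relabel_id: "relabel (\<lambda>x. x) g = g"
  by (simp add: relabel_def prod.map_ident)

lemma relabel_aromatic:
  assumes g: "aromatic g" and inj: "inj_on f (nodes g)"
  shows "aromatic (relabel f g)"
proof -
  have r: "set (roots g) \<subseteq> nodes g" and c: "set (covertices g) \<subseteq> nodes g"
    and v: "vertices g \<subseteq> nodes g" and e: "edges g \<subseteq> nodes g \<times> nodes g"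
    using g by (auto simp: aromatic_def nodes_def)
  have edge: "(f u, y) \<in> map_prod f f ` edges g \<longleftrightarrow> (\<exists>w. (u, w) \<in> edges g \<and> y = f w)"
    if "u \<in> nodes g" for u y
  proof
    assume "(f u, y) \<in> map_prod f f ` edges g"
    then obtain u' w where u'w: "(u', w) \<in> edges g" "f u = f u'" "y = f w" by auto
    then have "u' = u" using e inj that by (auto dest: inj_onD)
    then show "\<exists>w. (u, w) \<in> edges g \<and> y = f w" using u'w by auto
  next
    assume "\<exists>w. (u, w) \<in> edges g \<and> y = f w"
    then obtain w where "(u, w) \<in> edges g" "y = f w" by auto
    then show "(f u, y) \<in> map_prod f f ` edges g" by (force intro: rev_image_eqI)
  qed
  have 1: "f ` vertices g \<inter> f ` set (covertices g) = {}"
    using inj_on_image_Int[OF inj v c] g by (auto simp: aromatic_def)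
  have 2: "\<exists>!y. (z, y) \<in> map_prod f f ` edges g" if z: "z \<in> f ` nodes g - f ` set (roots g)" for z
  proof -
    from z obtain u where u: "u \<in> nodes g" "u \<notin> set (roots g)" "z = f u" by auto
    then have "\<exists>!w. (u, w) \<in> edges g" using g by (auto simp: aromatic_def)
    then show ?thesis unfolding u(3) edge[OF u(1)] by auto
  qed
  have 3: "(z, y) \<notin> map_prod f f ` edges g" if z: "z \<in> f ` set (roots g)" for z y
  proof -
    from z obtain u where u: "u \<in> set (roots g)" "z = f u" by auto
    then have "u \<in> nodes g" "\<forall>w. (u, w) \<notin> edges g" using g r by (auto simp: aromatic_def)
    then show ?thesis using edge[of u y] u by auto
  qed
  have 4: "distinct (map f (covertices g))" "distinct (map f (roots g))"
    using g inj_on_subset[OF inj c] inj_on_subset[OF inj r]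
    by (auto simp: aromatic_def distinct_map)
  have 5: "finite (f ` vertices g)" "map_prod f f ` edges g \<subseteq> f ` nodes g \<times> f ` nodes g"
    "f ` set (roots g) \<subseteq> f ` nodes g"
    using g e r by (auto simp: aromatic_def)
  show ?thesis
    unfolding aromatic_def relabel_simps set_map by (intro conjI ballI allI 1 2 3 4 5)
qed

lemma isomorphic_refl: "isomorphic g g"
  unfolding isomorphic_def by (rule exI[of _ "\<lambda>x. x"]) (simp add: relabel_id)

lemma isomorphic_trans:
  assumes "isomorphic g h" "isomorphic h k" shows "isomorphic g k"
proof -
  obtain f f' where f: "inj_on f (nodes g)" "h = relabel f g"
    and f': "inj_on f' (nodes h)" "k = relabel f' h"
    using assms by (auto simp: isomorphic_def)
  have "k = relabel (f' \<circ> f) g" by (simp add: f(2) f'(2) relabel_comp)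
  moreover have "inj_on (f' \<circ> f) (nodes g)" using f f' by (simp add: comp_inj_on)
  ultimately show ?thesis unfolding isomorphic_def by blast
qed

lemma isomorphic_sym:
  assumes g: "aromatic g" and "isomorphic g h" shows "isomorphic h g"
proof -
  obtain f where f: "inj_on f (nodes g)" "h = relabel f g"
    using assms by (auto simp: isomorphic_def)
  let ?f = "inv_into (nodes g) f"
  have "relabel (?f \<circ> f) g = relabel (\<lambda>x. x) g"
    by (rule relabel_cong[OF g]) (simp add: f(1))
  then have "g = relabel ?f h" by (simp add: f(2) relabel_comp relabel_id)
  moreover have "inj_on ?f (nodes h)" by (simp add: f(2) inj_on_inv_into)
  ultimately show ?thesis unfolding isomorphic_def by blast
qed

lemma isomorphic_aromatic: "aromatic g \<Longrightarrow> isomorphic g h \<Longrightarrow> aromatic h"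
  by (auto simp: isomorphic_def relabel_aromatic)

quotient_type forest = "nat agraph" / partial:
  "\<lambda>g h. aromatic g \<and> aromatic h \<and> isomorphic g h"
proof (rule part_equivpI)
  have "aromatic (\<lparr>vertices = {}, edges = {}, covertices = [], roots = []\<rparr> :: nat agraph)"
    by (simp add: aromatic_def nodes_def)
  then show "\<exists>g :: nat agraph. aromatic g \<and> aromatic g \<and> isomorphic g g"
    using isomorphic_refl by blast
  show "symp (\<lambda>g h :: nat agraph. aromatic g \<and> aromatic h \<and> isomorphic g h)"
    by (rule sympI) (blast intro: isomorphic_sym)
  show "transp (\<lambda>g h :: nat agraph. aromatic g \<and> aromatic h \<and> isomorphic g h)"
    by (rule transpI) (blast intro: isomorphic_trans)
qed

text \<open>The isomorphism class of a graph whose nodes may have any type.\<close>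

definition forest_of :: "'a agraph \<Rightarrow> forest" where
  "forest_of g = abs_forest (SOME h. isomorphic g h)"

lemma forest_of_cong:
  assumes "aromatic g" "isomorphic g h" shows "forest_of g = forest_of h"
proof -
  have "isomorphic g k \<longleftrightarrow> isomorphic h k" for k :: "nat agraph"
    using isomorphic_trans[OF isomorphic_sym[OF assms], of k] isomorphic_trans[OF assms(2), of k]
    by iprover
  then show ?thesis by (simp add: forest_of_def)
qed

lemma ex_isomorphic_nat:
  assumes "aromatic g" shows "\<exists>h :: nat agraph. isomorphic g h"
  using finite_imp_inj_to_nat_seg[OF aromatic_finite[OF assms]] by (auto simp: isomorphic_def)

lemma forest_of_eq_iff:
  assumes g: "aromatic g" and h: "aromatic h"
  shows "forest_of g = forest_of h \<longleftrightarrow> isomorphic g h"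
proof
  assume eq: "forest_of g = forest_of h"
  define g' h' :: "nat agraph"
    where "g' = (SOME k. isomorphic g k)" and "h' = (SOME k. isomorphic h k)"
  have g': "isomorphic g g'" and h': "isomorphic h h'"
    unfolding g'_def h'_def
    by (rule someI_ex[OF ex_isomorphic_nat[OF g]], rule someI_ex[OF ex_isomorphic_nat[OF h]])
  have "aromatic g'" "aromatic h'"
    by (rule isomorphic_aromatic[OF g g'], rule isomorphic_aromatic[OF h h'])
  moreover have "abs_forest g' = abs_forest h'"
    using eq unfolding forest_of_def g'_def h'_def .
  ultimately have "isomorphic g' h'"
    using Quotient_rel[OF Quotient_forest, of g' h'] by (simp add: isomorphic_refl)
  then show "isomorphic g h"
    by (rule isomorphic_trans[OF isomorphic_trans[OF g'] isomorphic_sym[OF h h']])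
qed (rule forest_of_cong[OF g])

lift_definition num_roots :: "forest \<Rightarrow> nat" is "\<lambda>g. length (roots g)"
  by (auto simp: isomorphic_def)

lift_definition num_covertices :: "forest \<Rightarrow> nat" is "\<lambda>g. length (covertices g)"
  by (auto simp: isomorphic_def)

definition forests :: "nat \<Rightarrow> nat \<Rightarrow> forest set" where
  "forests n p = {\<gamma>. num_roots \<gamma> = n \<and> num_covertices \<gamma> = p}"


section \<open>Aromatic forms\<close>

text \<open>All the forms live in the real vector space freely generated by all the aromatic forests.\<close>

type_synonym form = "forest \<Rightarrow>\<^sub>0 real"

abbreviation basis :: "forest \<Rightarrow> form" where
  "basis \<gamma> \<equiv> Poly_Mapping.single \<gamma> 1"

definition linear_ext :: "(forest \<Rightarrow> form) \<Rightarrow> form \<Rightarrow> form" where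
  "linear_ext F x = (\<Sum>\<gamma>\<in>Poly_Mapping.keys x. Poly_Mapping.lookup x \<gamma> *\<^sub>R F \<gamma>)"

text \<open>
  \<^const>\<open>permute_list\<close> moves the entry at position \<open>\<sigma> i\<close> to position \<open>i\<close>, i.e. it acts on the numbering
  by the inverse of \<open>\<sigma>\<close>; as the signature is invariant under inversion, this does not
  affect the alternating sums.
\<close>

definition wedge_roots_graph :: "'a agraph \<Rightarrow> form" where
  "wedge_roots_graph g = (let n = length (roots g) in
     (1 / fact n) *\<^sub>R (\<Sum>\<sigma> | \<sigma> permutes {..<n}.
        of_int (sign \<sigma>) *\<^sub>R basis (forest_of (g\<lparr>roots := permute_list \<sigma> (roots g)\<rparr>))))"

definition wedge_covertices_graph :: "'a agraph \<Rightarrow> form" where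
  "wedge_covertices_graph g = (let p = length (covertices g) in
     (1 / fact p) *\<^sub>R (\<Sum>\<sigma> | \<sigma> permutes {..<p}.
        of_int (sign \<sigma>) *\<^sub>R
          basis (forest_of (g\<lparr>covertices := permute_list \<sigma> (covertices g)\<rparr>))))"

lemma forest_of_permute_roots:
  assumes g: "aromatic g" and f: "inj_on f (nodes g)" and \<sigma>: "\<sigma> permutes {..<length (roots g)}"
  shows "forest_of ((relabel f g)\<lparr>roots := permute_list \<sigma> (map f (roots g))\<rparr>) =
         forest_of (g\<lparr>roots := permute_list \<sigma> (roots g)\<rparr>)"
proof (rule forest_of_cong[symmetric])
  let ?g = "g\<lparr>roots := permute_list \<sigma> (roots g)\<rparr>"
  have nd: "nodes ?g = nodes g" by (simp add: nodes_def)
  have "mset (permute_list \<sigma> (roots g)) = mset (roots g)" using \<sigma> by simp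
  then have "distinct (permute_list \<sigma> (roots g)) = distinct (roots g)"
    by (rule mset_eq_imp_distinct_iff)
  then show "aromatic ?g"
    using g unfolding aromatic_def nd by (simp add: set_permute_list[OF \<sigma>])
  show "isomorphic ?g ((relabel f g)\<lparr>roots := permute_list \<sigma> (map f (roots g))\<rparr>)"
    unfolding isomorphic_def using f
    by (intro exI[of _ f]) (simp add: nd relabel_def permute_list_map[OF \<sigma>])
qed

lemma forest_of_permute_covertices:
  assumes g: "aromatic g" and f: "inj_on f (nodes g)"
    and \<sigma>: "\<sigma> permutes {..<length (covertices g)}"
  shows "forest_of ((relabel f g)\<lparr>covertices := permute_list \<sigma> (map f (covertices g))\<rparr>) =
         forest_of (g\<lparr>covertices := permute_list \<sigma> (covertices g)\<rparr>)"
proof (rule forest_of_cong[symmetric])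
  let ?g = "g\<lparr>covertices := permute_list \<sigma> (covertices g)\<rparr>"
  have nd: "nodes ?g = nodes g" by (simp add: nodes_def set_permute_list[OF \<sigma>])
  have "mset (permute_list \<sigma> (covertices g)) = mset (covertices g)" using \<sigma> by simp
  then have "distinct (permute_list \<sigma> (covertices g)) = distinct (covertices g)"
    by (rule mset_eq_imp_distinct_iff)
  then show "aromatic ?g"
    using g unfolding aromatic_def nd by (simp add: set_permute_list[OF \<sigma>])
  show "isomorphic ?g ((relabel f g)\<lparr>covertices := permute_list \<sigma> (map f (covertices g))\<rparr>)"
    unfolding isomorphic_def using f
    by (intro exI[of _ f]) (simp add: nd relabel_def permute_list_map[OF \<sigma>])
qed

lemma wedge_roots_graph_relabel:
  assumes g: "aromatic g" and f: "inj_on f (nodes g)"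
  shows "wedge_roots_graph (relabel f g) = wedge_roots_graph g"
  unfolding wedge_roots_graph_def Let_def relabel_simps length_map
  by (intro arg_cong2[where f = scaleR] refl sum.cong arg_cong[where f = basis]
        forest_of_permute_roots[OF g f]) simp

lemma wedge_covertices_graph_relabel:
  assumes g: "aromatic g" and f: "inj_on f (nodes g)"
  shows "wedge_covertices_graph (relabel f g) = wedge_covertices_graph g"
  unfolding wedge_covertices_graph_def Let_def relabel_simps length_map
  by (intro arg_cong2[where f = scaleR] refl sum.cong arg_cong[where f = basis]
        forest_of_permute_covertices[OF g f]) simp

lift_definition wedge_roots_forest :: "forest \<Rightarrow> form" is wedge_roots_graph
  unfolding isomorphic_def using wedge_roots_graph_relabel by metis

lift_definition wedge_covertices_forest :: "forest \<Rightarrow> form" is wedge_covertices_graph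
  unfolding isomorphic_def using wedge_covertices_graph_relabel by metis

definition wedge_roots :: "form \<Rightarrow> form" where
  "wedge_roots = linear_ext wedge_roots_forest"

definition wedge_covertices :: "form \<Rightarrow> form" where
  "wedge_covertices = linear_ext wedge_covertices_forest"

definition wedge :: "form \<Rightarrow> form" where
  "wedge x = wedge_roots (wedge_covertices x)"

definition \<Omega> :: "nat \<Rightarrow> nat \<Rightarrow> form set" where
  "\<Omega> n p = wedge ` span (basis ` forests n p)"


section \<open>Horizontal and vertical derivatives\<close>

definition add_edge :: "'a \<Rightarrow> 'a \<Rightarrow> 'a agraph \<Rightarrow> 'a agraph" where
  "add_edge r u g = g\<lparr>edges := insert (r, u) (edges g), roots := remove1 r (roots g)\<rparr>"

definition D_graph :: "'a \<Rightarrow> 'a agraph \<Rightarrow> form" where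
  "D_graph r g = (\<Sum>u\<in>nodes g. basis (forest_of (add_edge r u g)))"

definition dH_graph :: "'a agraph \<Rightarrow> form" where
  "dH_graph g = (if roots g = [] then 0 else D_graph (last (roots g)) g)"

text \<open>Appending gives the new covertex the number \<open>p + 1\<close>.\<close>

definition to_covertex :: "'a \<Rightarrow> 'a agraph \<Rightarrow> 'a agraph" where
  "to_covertex v g = g\<lparr>vertices := vertices g - {v}, covertices := covertices g @ [v]\<rparr>"

definition verticals_graph :: "'a agraph \<Rightarrow> form" where
  "verticals_graph g = (\<Sum>v\<in>vertices g. basis (forest_of (to_covertex v g)))"

lemma map_remove1_inj_on:
  "inj_on f (insert x (set xs)) \<Longrightarrow> map f (remove1 x xs) = remove1 (f x) (map f xs)"
proof (induction xs)
  case (Cons a xs)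
  have "inj_on f (insert x (set xs))" using Cons.prems by (rule inj_on_subset) auto
  moreover have "f a = f x \<longleftrightarrow> a = x" by (rule inj_on_eq_iff[OF Cons.prems]) simp_all
  ultimately show ?case using Cons.IH by auto
qed simp

lemma aromatic_add_edge:
  assumes g: "aromatic g" and r: "r \<in> set (roots g)" and u: "u \<in> nodes g"
  shows "aromatic (add_edge r u g)"
proof -
  have nd: "nodes (add_edge r u g) = nodes g" by (simp add: nodes_def add_edge_def)
  have d: "distinct (roots g)" and rn: "r \<in> nodes g" and nr: "\<And>w. (r, w) \<notin> edges g"
    using g r by (auto simp: aromatic_def)
  have "\<exists>!w. (z, w) \<in> insert (r, u) (edges g)"
    if "z \<in> nodes g - (set (roots g) - {r})" for z
  proof (cases "z = r")
    case True then show ?thesis using nr by auto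
  next
    case False
    then have "\<exists>!w. (z, w) \<in> edges g" using that g by (auto simp: aromatic_def)
    then show ?thesis using False by auto
  qed
  then show ?thesis
    using g rn u unfolding aromatic_def nd
    by (simp add: add_edge_def set_remove1_eq[OF d]) (auto simp: aromatic_def)
qed

lemma aromatic_to_covertex:
  assumes g: "aromatic g" and v: "v \<in> vertices g"
  shows "aromatic (to_covertex v g)"
proof -
  have nd: "nodes (to_covertex v g) = nodes g" using v by (auto simp: nodes_def to_covertex_def)
  show ?thesis using g v unfolding aromatic_def nd by (auto simp: to_covertex_def)
qed

lemma D_graph_relabel:
  assumes g: "aromatic g" and f: "inj_on f (nodes g)" and r: "r \<in> set (roots g)"
  shows "D_graph (f r) (relabel f g) = D_graph r g"
proof -
  have rn: "insert r (set (roots g)) \<subseteq> nodes g" using g r by (auto simp: aromatic_def)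
  have "forest_of (add_edge (f r) (f u) (relabel f g)) = forest_of (add_edge r u g)"
    if u: "u \<in> nodes g" for u
  proof (rule forest_of_cong[symmetric])
    show "aromatic (add_edge r u g)" by (rule aromatic_add_edge[OF g r u])
    have "add_edge (f r) (f u) (relabel f g) = relabel f (add_edge r u g)"
      by (simp add: add_edge_def relabel_def map_remove1_inj_on[OF inj_on_subset[OF f rn]])
    moreover have "nodes (add_edge r u g) = nodes g" by (simp add: nodes_def add_edge_def)
    ultimately show "isomorphic (add_edge r u g) (add_edge (f r) (f u) (relabel f g))"
      unfolding isomorphic_def using f by auto
  qed
  then show ?thesis unfolding D_graph_def relabel_simps by (simp add: sum.reindex[OF f])
qed

lemma dH_graph_relabel:
  assumes "aromatic g" "inj_on f (nodes g)"
  shows "dH_graph (relabel f g) = dH_graph g"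
  using D_graph_relabel[OF assms, of "last (roots g)"] by (simp add: dH_graph_def last_map)

lemma verticals_graph_relabel:
  assumes g: "aromatic g" and f: "inj_on f (nodes g)"
  shows "verticals_graph (relabel f g) = verticals_graph g"
proof -
  have fv: "inj_on f (vertices g)" using f by (rule inj_on_subset) (auto simp: nodes_def)
  have "forest_of (to_covertex (f v) (relabel f g)) = forest_of (to_covertex v g)"
    if v: "v \<in> vertices g" for v
  proof (rule forest_of_cong[symmetric])
    show "aromatic (to_covertex v g)" by (rule aromatic_to_covertex[OF g v])
    have "f ` (vertices g - {v}) = f ` vertices g - {f v}"
      using inj_on_image_set_diff[OF fv, of "vertices g" "{v}"] v by auto
    then have "to_covertex (f v) (relabel f g) = relabel f (to_covertex v g)"
      by (simp add: to_covertex_def relabel_def)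
    moreover have "nodes (to_covertex v g) = nodes g"
      using v by (auto simp: nodes_def to_covertex_def)
    ultimately show "isomorphic (to_covertex v g) (to_covertex (f v) (relabel f g))"
      unfolding isomorphic_def using f by auto
  qed
  then show ?thesis unfolding verticals_graph_def relabel_simps by (simp add: sum.reindex[OF fv])
qed

lift_definition dH_forest :: "forest \<Rightarrow> form" is dH_graph
  unfolding isomorphic_def using dH_graph_relabel by metis

lift_definition verticals_forest :: "forest \<Rightarrow> form" is verticals_graph
  unfolding isomorphic_def using verticals_graph_relabel by metis

definition dH :: "form \<Rightarrow> form" where
  "dH = linear_ext dH_forest"

definition dV_forest :: "forest \<Rightarrow> form" where
  "dV_forest \<gamma> = wedge (verticals_forest \<gamma>)"

definition dV :: "form \<Rightarrow> form" where
  "dV = linear_ext dV_forest"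

definition d_total :: "form \<Rightarrow> form" where
  "d_total = linear_ext (\<lambda>\<gamma>.
     (-1) ^ (num_roots \<gamma> + num_covertices \<gamma>) *\<^sub>R dH_forest \<gamma> + dV_forest \<gamma>)"


section \<open>Contraction and Lie derivative\<close>

text \<open>
  The graph obtained from \<open>g\<close> on replacing the covertex \<open>k\<close> by the graph \<open>t\<close> with one root
  and no covertex, the predecessor \<open>u\<close> of \<open>k\<close> being grafted onto the node \<open>\<phi> u\<close> of \<open>t\<close>. If \<open>k\<close> carries a loop, then
  \<open>k\<close> is one of its own predecessors, and the loop becomes an edge from the root of \<open>t\<close> to \<open>\<phi> k\<close>.
\<close>

definition substitute :: "('a \<Rightarrow> 'b) \<Rightarrow> 'b agraph \<Rightarrow> 'a \<Rightarrow> 'a agraph \<Rightarrow> ('a + 'b) agraph" where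
  "substitute \<phi> t k g =
     (let src = (\<lambda>u. if u = k then Inr (hd (roots t)) else Inl u);
          tgt = (\<lambda>u w. if w = k then Inr (\<phi> u) else Inl w)
      in \<lparr>vertices = Inl ` vertices g \<union> Inr ` vertices t,
          edges = (\<lambda>(u, w). (src u, tgt u w)) ` edges g \<union> map_prod Inr Inr ` edges t,
          covertices = map Inl (remove1 k (covertices g)),
          roots = map src (roots g)\<rparr>)"

definition predecessors :: "'a agraph \<Rightarrow> 'a \<Rightarrow> 'a set" where
  "predecessors g u = {v. (v, u) \<in> edges g}"

definition substitution_graph :: "'b agraph \<Rightarrow> 'a \<Rightarrow> 'a agraph \<Rightarrow> form" where
  "substitution_graph t k g =
     (\<Sum>\<phi>\<in>predecessors g k \<rightarrow>\<^sub>E nodes t. basis (forest_of (substitute \<phi> t k g)))"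

text \<open>
  Contraction is only meaningful for \<open>t\<close> with one root and no covertex; it is set to 0 for
  all the other \<open>t\<close>.
\<close>

definition contraction_graph :: "'b agraph \<Rightarrow> 'a agraph \<Rightarrow> form" where
  "contraction_graph t g =
     (if length (roots t) = 1 \<and> covertices t = [] \<and> covertices g \<noteq> []
      then real (length (covertices g)) *\<^sub>R substitution_graph t (last (covertices g)) g
      else 0)"

lemma aromatic_substitute:
  assumes g: "aromatic g" and k: "k \<in> set (covertices g)"
    and t: "aromatic t" "length (roots t) = 1" "covertices t = []"
    and \<phi>: "\<phi> \<in> predecessors g k \<rightarrow>\<^sub>E nodes t"
  shows "aromatic (substitute \<phi> t k g)"
proof -
  obtain r where r: "roots t = [r]" using t(2) by (auto simp: length_Suc_conv)
  define src where "src = (\<lambda>u. if u = k then Inr (hd (roots t)) else Inl u :: 'a + 'b)"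
  define tgt where "tgt = (\<lambda>u w. if w = k then Inr (\<phi> u) else Inl w :: 'a + 'b)"
  let ?s = "substitute \<phi> t k g"
  have dc: "distinct (covertices g)" and kv: "k \<notin> vertices g"
    using g k by (auto simp: aromatic_def)
  have rt: "r \<in> nodes t" using t(1) r by (auto simp: aromatic_def)
  have src_inj: "src u = src v \<longleftrightarrow> u = v" for u v by (simp add: src_def)
  have es: "edges ?s = (\<lambda>(u, w). (src u, tgt u w)) ` edges g \<union> map_prod Inr Inr ` edges t"
    and rs: "roots ?s = map src (roots g)"
    and cs: "covertices ?s = map Inl (remove1 k (covertices g))"
    and vs: "vertices ?s = Inl ` vertices g \<union> Inr ` vertices t"
    by (simp_all add: substitute_def src_def tgt_def)
  have nd: "nodes ?s = Inl ` (nodes g - {k}) \<union> Inr ` nodes t"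
    unfolding nodes_def vs cs using kv t(3) by (auto simp: set_remove1_eq[OF dc])
  have src_nd: "src u \<in> nodes ?s" if "u \<in> nodes g" for u
    unfolding nd using that rt r by (auto simp: src_def)
  have tgt_nd: "tgt u w \<in> nodes ?s" if "(u, w) \<in> edges g" for u w
  proof (cases "w = k")
    case True
    then have "\<phi> u \<in> nodes t" using that \<phi> by (auto simp: predecessors_def)
    then show ?thesis unfolding nd using True by (simp add: tgt_def)
  next
    case False
    then show ?thesis unfolding nd using aromatic_edgeD[OF g that] by (simp add: tgt_def)
  qed
  have src_t: "(src u, y) \<notin> map_prod Inr Inr ` edges t" for u y
    using t(1) r by (auto simp: src_def aromatic_def split: if_splits)
  have esrc: "(src u, y) \<in> edges ?s \<longleftrightarrow> (\<exists>w. (u, w) \<in> edges g \<and> y = tgt u w)" for u y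
  proof -
    have "(src u, y) \<in> (\<lambda>(u, w). (src u, tgt u w)) ` edges g \<longleftrightarrow>
        (\<exists>w. (u, w) \<in> edges g \<and> y = tgt u w)"
      using src_inj by (auto intro: rev_image_eqI)
    then show ?thesis by (simp only: es Un_iff src_t simp_thms)
  qed
  have einr: "(Inr v, y) \<in> edges ?s \<longleftrightarrow> (\<exists>w. (v, w) \<in> edges t \<and> y = Inr w)"
    if "v \<noteq> r" for v y
    unfolding es using that r by (auto simp: src_def split: if_splits intro: rev_image_eqI)
  have e_sub: "edges ?s \<subseteq> nodes ?s \<times> nodes ?s"
  proof
    fix e assume "e \<in> edges ?s"
    then consider u w where "(u, w) \<in> edges g" "e = (src u, tgt u w)"
      | u w where "(u, w) \<in> edges t" "e = (Inr u, Inr w)" unfolding es by auto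
    then show "e \<in> nodes ?s \<times> nodes ?s"
    proof cases
      case 1
      then show ?thesis using src_nd tgt_nd aromatic_edgeD[OF g 1(1)] by simp
    next
      case 2
      then show ?thesis unfolding nd using aromatic_edgeD[OF t(1) 2(1)] by simp
    qed
  qed
  have fin: "finite (vertices ?s)" and disc: "distinct (covertices ?s)"
    and disj: "vertices ?s \<inter> set (covertices ?s) = {}"
    unfolding vs cs using g t(1) dc
    by (auto simp: aromatic_def distinct_map set_remove1_eq[OF dc])
  have disr: "distinct (roots ?s)"
    unfolding rs using g src_inj by (auto simp: aromatic_def distinct_map inj_on_def)
  have r_sub: "set (roots ?s) \<subseteq> nodes ?s"
    using g src_nd by (auto simp: rs aromatic_def)
  have no_out: "(x, y) \<notin> edges ?s" if "x \<in> set (roots ?s)" for x y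
    using that g by (auto simp: rs esrc aromatic_def)
  have out: "\<exists>!y. (x, y) \<in> edges ?s" if x: "x \<in> nodes ?s - set (roots ?s)" for x
  proof -
    have *: "(\<exists>u\<in>nodes g. x = src u) \<or> (\<exists>v\<in>nodes t. v \<noteq> r \<and> x = Inr v)"
    proof (cases x)
      case (Inl u)
      then show ?thesis using x unfolding nd by (auto simp: src_def)
    next
      case (Inr v)
      have "k \<in> nodes g" using k by (simp add: nodes_def)
      then show ?thesis using x Inr r unfolding nd by (auto simp: src_def)
    qed
    then show ?thesis
    proof (elim disjE bexE conjE)
      fix u assume u: "u \<in> nodes g" "x = src u"
      then have "u \<notin> set (roots g)" using x by (auto simp: rs)
      then have "\<exists>!w. (u, w) \<in> edges g" using u g by (auto simp: aromatic_def)
      then show ?thesis unfolding u(2) esrc by auto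
    next
      fix v assume v: "v \<in> nodes t" "v \<noteq> r" "x = Inr v"
      then have "\<exists>!w. (v, w) \<in> edges t" using t(1) r by (auto simp: aromatic_def)
      then show ?thesis unfolding v(3) einr[OF v(2)] by auto
    qed
  qed
  show ?thesis
    unfolding aromatic_def
    by (intro conjI ballI allI fin disc disj e_sub disr r_sub no_out out)
qed

lemma substitute_relabel:
  fixes f :: "'a \<Rightarrow> 'c" and f' :: "'b \<Rightarrow> 'd"
  assumes g: "aromatic g" and k: "k \<in> set (covertices g)" and f: "inj_on f (nodes g)"
    and t: "aromatic t" "length (roots t) = 1" "covertices t = []"
    and \<psi>: "\<And>u. u \<in> predecessors g k \<Longrightarrow> \<psi> (f u) = f' (\<phi> u)"
  shows "substitute \<psi> (relabel f' t) (f k) (relabel f g) =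
         relabel (map_sum f f') (substitute \<phi> t k g)"
proof -
  obtain r where r: "roots t = [r]" using t(2) by (auto simp: length_Suc_conv)
  have kn: "k \<in> nodes g" using k by (simp add: nodes_def)
  have fk: "f u = f k \<longleftrightarrow> u = k" if "u \<in> nodes g" for u
    using inj_on_eq_iff[OF f that kn] .
  have rn: "set (roots g) \<subseteq> nodes g" using g by (simp add: aromatic_def)
  have cn: "insert k (set (covertices g)) \<subseteq> nodes g" using k by (auto simp: nodes_def)
  have fe: "f u = f k \<longleftrightarrow> u = k" "f w = f k \<longleftrightarrow> w = k" if "(u, w) \<in> edges g" for u w
    using fk aromatic_edgeD[OF g that] by simp_all
  have pe: "\<psi> (f u) = f' (\<phi> u)" if "(u, k) \<in> edges g" for u
    using that by (intro \<psi>) (simp add: predecessors_def)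
  have cov: "map Inl (remove1 (f k) (map f (covertices g))) =
      map (\<lambda>x. Inl (f x) :: 'c + 'd) (remove1 k (covertices g))"
    by (simp flip: map_remove1_inj_on[OF inj_on_subset[OF f cn]])
  show ?thesis
    unfolding substitute_def relabel_def Let_def r
    using fk rn
    by (auto simp: image_Un image_image r map_prod.comp prod.map_comp comp_def fe pe cov
        intro!: arg_cong2[where f = "(\<union>)"] image_cong[OF refl])
qed

lemma predecessors_relabel:
  assumes g: "aromatic g" and k: "k \<in> nodes g" and f: "inj_on f (nodes g)"
  shows "predecessors (relabel f g) (f k) = f ` predecessors g k"
proof -
  have "f w = f k \<longleftrightarrow> w = k" if "(u, w) \<in> edges g" for u w
    using inj_on_eq_iff[OF f _ k] aromatic_edgeD[OF g that] by blast
  then show ?thesis by (force simp: predecessors_def)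
qed

lemma substitution_graph_relabel:
  assumes g: "aromatic g" and k: "k \<in> set (covertices g)" and f: "inj_on f (nodes g)"
    and t: "aromatic t" "length (roots t) = 1" "covertices t = []" and f': "inj_on f' (nodes t)"
  shows "substitution_graph (relabel f' t) (f k) (relabel f g) = substitution_graph t k g"
proof -
  let ?P = "predecessors g k" and ?N = "nodes t"
  have kn: "k \<in> nodes g" using k by (simp add: nodes_def)
  have Pn: "?P \<subseteq> nodes g" using aromatic_edgeD[OF g] by (auto simp: predecessors_def)
  have fP: "inj_on f ?P" using f Pn by (rule inj_on_subset)
  have P: "predecessors (relabel f g) (f k) = f ` ?P" by (rule predecessors_relabel[OF g kn f])
  define push where
    "push \<phi> = restrict (\<lambda>y. f' (\<phi> (inv_into ?P f y))) (f ` ?P)" for \<phi>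
  define pull where
    "pull \<psi> = restrict (\<lambda>u. inv_into ?N f' (\<psi> (f u))) ?P" for \<psi>
  show ?thesis
    unfolding substitution_graph_def P relabel_simps(5)
  proof (rule sum.reindex_bij_witness[where i = push and j = pull])
    fix \<psi> assume \<psi>: "\<psi> \<in> f ` ?P \<rightarrow>\<^sub>E f' ` ?N"
    have \<psi>_in: "\<psi> (f u) \<in> f' ` ?N" if "u \<in> ?P" for u using \<psi> that by auto
    show pull: "pull \<psi> \<in> ?P \<rightarrow>\<^sub>E ?N"
      unfolding pull_def using \<psi>_in by (auto simp: PiE_iff intro: inv_into_into)
    show "push (pull \<psi>) = \<psi>"
    proof
      fix y
      show "push (pull \<psi>) y = \<psi> y"
      proof (cases "y \<in> f ` ?P")
        case True
        then obtain u where u: "u \<in> ?P" "y = f u" by auto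
        then show ?thesis using f_inv_into_f[OF \<psi>_in[OF u(1)]] fP
          by (simp add: push_def pull_def)
      next
        case False
        then show ?thesis using \<psi> by (auto simp: push_def PiE_iff extensional_def)
      qed
    qed
    have \<psi>_eq: "\<psi> (f u) = f' (pull \<psi> u)" if "u \<in> ?P" for u
      using f_inv_into_f[OF \<psi>_in[OF that]] that by (simp add: pull_def)
    have eq: "substitute \<psi> (relabel f' t) (f k) (relabel f g) =
        relabel (map_sum f f') (substitute (pull \<psi>) t k g)"
      by (rule substitute_relabel[OF g k f t]) (rule \<psi>_eq)
    have ar: "aromatic (substitute (pull \<psi>) t k g)"
      by (rule aromatic_substitute[OF g k t pull])
    have sub: "nodes (substitute (pull \<psi>) t k g) \<subseteq> Inl ` nodes g \<union> Inr ` nodes t"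
      using set_remove1_subset[of k "covertices g"] by (auto simp: nodes_def substitute_def Let_def)
    have "inj_on (map_sum f f') (Inl ` nodes g \<union> Inr ` nodes t)"
      by (rule inj_onI) (auto dest: inj_onD[OF f] inj_onD[OF f'])
    then have "inj_on (map_sum f f') (nodes (substitute (pull \<psi>) t k g))"
      using sub by (rule inj_on_subset)
    then have iso: "isomorphic (substitute (pull \<psi>) t k g)
        (substitute \<psi> (relabel f' t) (f k) (relabel f g))"
      unfolding isomorphic_def using eq by blast
    show "basis (forest_of (substitute (pull \<psi>) t k g)) =
        basis (forest_of (substitute \<psi> (relabel f' t) (f k) (relabel f g)))"
      by (simp only: forest_of_cong[OF ar iso])
  next
    fix \<phi> assume \<phi>: "\<phi> \<in> ?P \<rightarrow>\<^sub>E ?N"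
    show "push \<phi> \<in> f ` ?P \<rightarrow>\<^sub>E f' ` ?N"
      using \<phi> fP by (auto simp: push_def PiE_iff)
    show "pull (push \<phi>) = \<phi>"
    proof
      fix u
      show "pull (push \<phi>) u = \<phi> u"
      proof (cases "u \<in> ?P")
        case True
        then have "\<phi> u \<in> ?N" using \<phi> by auto
        then show ?thesis using True fP f' by (simp add: push_def pull_def)
      next
        case False
        then show ?thesis using \<phi> by (auto simp: pull_def PiE_iff extensional_def)
      qed
    qed
  qed
qed

lemma contraction_graph_relabel:
  assumes t: "aromatic t" "inj_on f' (nodes t)" and g: "aromatic g" "inj_on f (nodes g)"
  shows "contraction_graph (relabel f' t) (relabel f g) = contraction_graph t g"
  using substitution_graph_relabel[OF g(1) _ g(2) t(1) _ _ t(2), of "last (covertices g)"]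
  by (simp add: contraction_graph_def last_map)

lift_definition contraction_forest :: "forest \<Rightarrow> forest \<Rightarrow> form" is contraction_graph
  unfolding isomorphic_def using contraction_graph_relabel by metis

definition contraction :: "form \<Rightarrow> form \<Rightarrow> form" where
  "contraction \<tau> x = linear_ext (\<lambda>t. linear_ext (contraction_forest t) x) \<tau>"

definition Lie :: "form \<Rightarrow> form \<Rightarrow> form" where
  "Lie \<tau> x = d_total (contraction \<tau> x) + contraction \<tau> (d_total x)"


section \<open>Homotopy operators and symmetries\<close>

text \<open>\<open>h n p\<close> is the operator from \<open>\<Omega> n p\<close> to \<open>\<Omega> (n + 1) p\<close>; its values elsewhere are irrelevant.\<close>

definition homotopy_operators :: "(nat \<Rightarrow> nat \<Rightarrow> form \<Rightarrow> form) \<Rightarrow> bool" where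
  "homotopy_operators h \<longleftrightarrow>
     (\<forall>n p. h n p ` \<Omega> n p \<subseteq> \<Omega> (n + 1) p \<and>
        (\<forall>x\<in>\<Omega> n p. \<forall>y\<in>\<Omega> n p. h n p (x + y) = h n p x + h n p y) \<and>
        (\<forall>c. \<forall>x\<in>\<Omega> n p. h n p (c *\<^sub>R x) = c *\<^sub>R h n p x)) \<and>
     (\<forall>n\<ge>1. \<forall>p. \<forall>x\<in>\<Omega> n p. x = dH (h n p x) + h (n - 1) p (dH x))"

definition Lie_homotopy ::
    "(nat \<Rightarrow> nat \<Rightarrow> form \<Rightarrow> form) \<Rightarrow> nat \<Rightarrow> nat \<Rightarrow> form \<Rightarrow> form \<Rightarrow> form" where
  "Lie_homotopy h n p \<tau> x = Lie \<tau> (h n p x)"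

definition symmetry :: "form \<Rightarrow> form \<Rightarrow> bool" where
  "symmetry \<tau> x \<longleftrightarrow> \<tau> \<in> \<Omega> 1 0 \<and> Lie \<tau> x = 0"

definition divergence_symmetry :: "form \<Rightarrow> form \<Rightarrow> bool" where
  "divergence_symmetry \<tau> x \<longleftrightarrow> \<tau> \<in> \<Omega> 1 0 \<and> (\<exists>n p. \<exists>\<eta>\<in>\<Omega> n p. Lie \<tau> x = dH \<eta>)"

end

theory Submission
  imports Defs
begin

text \<open>
  Everything rests on one fact: on forms without covertices the Lie derivative commutes with
  the horizontal derivative (\<open>Lie_dH\<close>).

  The reason is combinatorial. If \<open>x\<close> has no covertex, contraction annihilates both \<open>x\<close> and its
  horizontal derivative, and since \<open>x\<close> is alternating in its roots the form obtained by turning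
  each vertex in turn into a covertex is already alternating, so the wedge in the vertical
  derivative does nothing. Hence \<open>Lie \<tau> x\<close> is simply the sum of all ways to replace a vertex \<open>v\<close>
  by \<open>\<tau>\<close>, grafting the predecessors of \<open>v\<close> on arbitrary nodes of \<open>\<tau>\<close> (\<open>Lie_eq\<close>). The horizontal
  derivative adds an edge from the last root to an arbitrary node. After the replacement, the
  target of this edge is either an old node different from \<open>v\<close>, which gives the forests in which
  the edge is added first and another vertex than its target is replaced, or a node of \<open>\<tau>\<close>, which
  gives the forests in which the edge is first added with target \<open>v\<close> and the last root is then
  grafted on \<open>\<tau>\<close> as one more predecessor of \<open>v\<close>
  (\<open>substitute_add_edge_other\<close>, \<open>substitute_add_edge_same\<close>).

  Consequently \<open>Lie \<tau> (dH \<gamma>') = dH (Lie \<tau> \<gamma>')\<close>, so every \<open>\<tau>\<close> is a divergence symmetry of \<open>dH \<gamma>'\<close>;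
  and if \<open>Lie \<tau> \<gamma>'\<close> is itself horizontally exact, then \<open>Lie \<tau> (dH \<gamma>') = 0\<close> because the horizontal
  derivative squares to zero on alternating forms: the two edges added come from the last two
  roots, and exchanging these changes the sign of the form but not the result (\<open>dH_dH_Omega\<close>).
  Finally the homotopy identity reads \<open>\<gamma>' = dH \<zeta> + h \<gamma>\<close> with \<open>\<zeta>\<close> of three roots, whence
  \<open>Lie \<tau> \<gamma>'\<close> and \<open>Lie \<tau> (h \<gamma>)\<close> differ by the horizontal derivative of \<open>Lie \<tau> \<zeta>\<close>.

  Since spaces of forms are images of the wedge, they are first identified with the forms on which
  permutations of the roots act by their sign (\<open>Omega_iff_alternating\<close>); an operator which
  commutes with these permutations then preserves forms (\<open>equivariant_Omega\<close>).
\<close>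

section \<open>Linear extension\<close>

lemma lookup_scaleR: "Poly_Mapping.lookup (c *\<^sub>R x) k = c * Poly_Mapping.lookup x k"
  for x :: "'a \<Rightarrow>\<^sub>0 real"
proof -
  have "finite {i. c * Poly_Mapping.lookup x i \<noteq> 0}"
    by (rule finite_subset[OF _ finite_lookup[of x]]) auto
  then show ?thesis by (simp add: scaleR_poly_mapping_def Abs_poly_mapping_inverse)
qed

lemma linear_ext_superset:
  assumes "finite S" "Poly_Mapping.keys x \<subseteq> S"
  shows "linear_ext F x = (\<Sum>\<gamma>\<in>S. Poly_Mapping.lookup x \<gamma> *\<^sub>R F \<gamma>)"
  unfolding linear_ext_def using assms
  by (intro sum.mono_neutral_left) (auto simp: in_keys_iff)

lemma linear_linear_ext: "linear (linear_ext F)"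
proof (rule linearI)
  fix x y :: form and c :: real
  let ?S = "Poly_Mapping.keys x \<union> Poly_Mapping.keys y"
  have "Poly_Mapping.keys (x + y) \<subseteq> ?S" by (rule Poly_Mapping.keys_add)
  then show "linear_ext F (x + y) = linear_ext F x + linear_ext F y"
    using linear_ext_superset[of ?S x F] linear_ext_superset[of ?S y F]
      linear_ext_superset[of ?S "x + y" F]
    by (simp add: lookup_add scaleR_add_left sum.distrib)
  have "Poly_Mapping.keys (c *\<^sub>R x) \<subseteq> Poly_Mapping.keys x"
    by (auto simp: in_keys_iff lookup_scaleR)
  then show "linear_ext F (c *\<^sub>R x) = c *\<^sub>R linear_ext F x"
    using linear_ext_superset[of "Poly_Mapping.keys x" x F]
      linear_ext_superset[of "Poly_Mapping.keys x" "c *\<^sub>R x" F]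
    by (simp add: lookup_scaleR scaleR_sum_right)
qed

lemma linear_ext_basis [simp]: "linear_ext F (basis \<gamma>) = F \<gamma>"
  by (simp add: linear_ext_def)

lemmas linear_ext_sum = linear_sum[OF linear_linear_ext]
  and linear_ext_0 = linear_0[OF linear_linear_ext]

lemma linear_apply_linear_ext:
  "linear L \<Longrightarrow> L (linear_ext F x) = linear_ext (\<lambda>\<gamma>. L (F \<gamma>)) x"
  by (simp add: linear_ext_def linear_sum linear_scale)

lemma linear_ext_in_subspace: "subspace W \<Longrightarrow> (\<And>\<gamma>. F \<gamma> \<in> W) \<Longrightarrow> linear_ext F x \<in> W"
  unfolding linear_ext_def by (intro subspace_sum subspace_scale)

abbreviation forms :: "nat \<Rightarrow> nat \<Rightarrow> form set" where
  "forms n p \<equiv> span (basis ` forests n p)"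

lemma basis_in_forms: "\<gamma> \<in> forests n p \<Longrightarrow> basis \<gamma> \<in> forms n p"
  by (simp add: span_base)

lemma linear_eq_on_forms:
  assumes "linear F" "linear G" "\<And>\<gamma>. \<gamma> \<in> forests n p \<Longrightarrow> F (basis \<gamma>) = G (basis \<gamma>)" "x \<in> forms n p"
  shows "F x = G x"
  using linear_eq_on_span[of F G "basis ` forests n p" x] assms by auto

lemma linear_forms:
  assumes "linear F" "subspace W" "\<And>\<gamma>. \<gamma> \<in> forests n p \<Longrightarrow> F (basis \<gamma>) \<in> W" "x \<in> forms n p"
  shows "F x \<in> W"
proof -
  have "F ` forms n p = span (F ` basis ` forests n p)" using assms(1) by (simp add: span_linear_image)
  also have "\<dots> \<subseteq> W" by (rule span_minimal[OF _ assms(2)]) (use assms(3) in auto)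
  finally show ?thesis using assms(4) by auto
qed

lemma keys_forms: "x \<in> forms n p \<Longrightarrow> Poly_Mapping.keys x \<subseteq> forests n p"
proof (induction rule: span_induct_alt)
  case (step c b y)
  have "Poly_Mapping.keys (c *\<^sub>R b) \<subseteq> forests n p"
    using step(1)
    by (auto simp: in_keys_iff lookup_scaleR lookup_single when_def split: if_splits)
  then show ?case using step Poly_Mapping.keys_add[of "c *\<^sub>R b" y] by auto
qed simp

text \<open>
  A nonzero form determines its numbers of roots and covertices; this pins down the bidegree of the
  form \<open>\<eta>\<close> that the notion of divergence symmetry leaves open.
\<close>

lemma forms_disjoint:
  assumes "x \<in> forms n p" "x \<in> forms m q" "x \<noteq> 0" shows "n = m \<and> p = q"
proof -
  have "Poly_Mapping.keys x \<noteq> {}" using assms by simp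
  then obtain \<gamma> where "\<gamma> \<in> Poly_Mapping.keys x" by blast
  then show ?thesis using keys_forms[OF assms(1)] keys_forms[OF assms(2)] by (auto simp: forests_def)
qed

section \<open>Forests and their graphs\<close>

lemma forest_of_eq_abs_forest:
  fixes g :: "nat agraph"
  assumes g: "aromatic g" shows "forest_of g = abs_forest g"
proof -
  have 1: "isomorphic g (SOME h :: nat agraph. isomorphic g h)"
    by (rule someI[of "isomorphic g" g]) (rule isomorphic_refl)
  show ?thesis unfolding forest_of_def
    using Quotient_rel_abs[OF Quotient_forest, of g "SOME h. isomorphic g h"]
      g 1 isomorphic_aromatic[OF g 1] by simp
qed

lemma forest_cases:
  obtains g :: "nat agraph" where "aromatic g" "\<gamma> = forest_of g"
proof -
  have "aromatic (rep_forest \<gamma>)" using Quotient_rep_reflp[OF Quotient_forest] by blast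
  then show ?thesis
    using that[of "rep_forest \<gamma>"] forest_of_eq_abs_forest Quotient_abs_rep[OF Quotient_forest] by metis
qed

text \<open>
  The operators on forests are lifted from graphs on natural numbers, whereas substitution produces
  graphs on a sum type. Relabelling the nodes by natural numbers transfers the defining equation of
  each operator to graphs with nodes of any type.
\<close>

lemma forest_of_nat_graph:
  assumes "aromatic g"
  obtains f :: "'a \<Rightarrow> nat" where "inj_on f (nodes g)" "aromatic (relabel f g)"
    "forest_of g = abs_forest (relabel f g)"
proof -
  obtain f :: "'a \<Rightarrow> nat" where f: "inj_on f (nodes g)"
    using finite_imp_inj_to_nat_seg[OF aromatic_finite[OF assms]] by auto
  have a: "aromatic (relabel f g)" using relabel_aromatic assms f by blast
  have "forest_of g = forest_of (relabel f g)"
    using forest_of_cong[OF assms] f isomorphic_def by blast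
  then show ?thesis using that f a forest_of_eq_abs_forest[OF a] by simp
qed

lemma num_roots_forest_of: "aromatic g \<Longrightarrow> num_roots (forest_of g) = length (roots g)"
  by (erule forest_of_nat_graph) (simp add: num_roots.abs_eq isomorphic_refl)

lemma num_covertices_forest_of: "aromatic g \<Longrightarrow> num_covertices (forest_of g) = length (covertices g)"
  by (erule forest_of_nat_graph) (simp add: num_covertices.abs_eq isomorphic_refl)

lemma dH_forest_of: assumes g: "aromatic g" shows "dH_forest (forest_of g) = dH_graph g"
  using g by (rule forest_of_nat_graph)
    (simp add: dH_forest.abs_eq isomorphic_refl dH_graph_relabel[OF g])

lemma verticals_forest_of:
  assumes g: "aromatic g" shows "verticals_forest (forest_of g) = verticals_graph g"
  using g by (rule forest_of_nat_graph)
    (simp add: verticals_forest.abs_eq isomorphic_refl verticals_graph_relabel[OF g])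

lemma wedge_roots_forest_of:
  assumes g: "aromatic g" shows "wedge_roots_forest (forest_of g) = wedge_roots_graph g"
  using g by (rule forest_of_nat_graph)
    (simp add: wedge_roots_forest.abs_eq isomorphic_refl wedge_roots_graph_relabel[OF g])

lemma wedge_covertices_forest_of:
  assumes g: "aromatic g" shows "wedge_covertices_forest (forest_of g) = wedge_covertices_graph g"
  using g by (rule forest_of_nat_graph)
    (simp add: wedge_covertices_forest.abs_eq isomorphic_refl wedge_covertices_graph_relabel[OF g])

lemma contraction_forest_of:
  assumes t: "aromatic t" and g: "aromatic g"
  shows "contraction_forest (forest_of t) (forest_of g) = contraction_graph t g"
proof -
  obtain f where f: "inj_on f (nodes g)" "aromatic (relabel f g)"
    "forest_of g = abs_forest (relabel f g)" using forest_of_nat_graph[OF g] .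
  obtain f' where f': "inj_on f' (nodes t)" "aromatic (relabel f' t)"
    "forest_of t = abs_forest (relabel f' t)" using forest_of_nat_graph[OF t] .
  show ?thesis using contraction_graph_relabel[OF t f'(1) g f(1)]
    by (simp add: f(3) f'(3) contraction_forest.abs_eq f(2) f'(2) isomorphic_refl)
qed

lemma forests_cases:
  assumes "\<gamma> \<in> forests n p"
  obtains g :: "nat agraph" where "aromatic g" "\<gamma> = forest_of g"
    "length (roots g) = n" "length (covertices g) = p"
  using assms forest_cases[of \<gamma>]
  by (metis (mono_tags, lifting) forests_def mem_Collect_eq num_roots_forest_of num_covertices_forest_of)

lemma forest_of_in_forests:
  "aromatic g \<Longrightarrow> forest_of g \<in> forests (length (roots g)) (length (covertices g))"
  by (simp add: forests_def num_roots_forest_of num_covertices_forest_of)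

section \<open>Alternating forms\<close>

abbreviation permute_roots_of :: "(nat \<Rightarrow> nat) \<Rightarrow> 'a agraph \<Rightarrow> 'a agraph" where
  "permute_roots_of \<sigma> g \<equiv> g\<lparr>roots := permute_list \<sigma> (roots g)\<rparr>"

lemma nodes_roots_update [simp]: "nodes (g\<lparr>roots := rs\<rparr>) = nodes g"
  by (simp add: nodes_def)

lemma aromatic_permute_roots:
  assumes g: "aromatic g" and \<sigma>: "\<sigma> permutes {..<length (roots g)}"
  shows "aromatic (permute_roots_of \<sigma> g)"
  using g unfolding aromatic_def by (simp add: \<sigma>)

text \<open>
  Relabelling the nodes respects the permuted list of roots only if \<open>\<sigma>\<close> stays within the positions of
  that list; the default value 0 makes the operator well defined on forests for every \<open>\<sigma>\<close>.
\<close>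

definition permute_roots_graph :: "(nat \<Rightarrow> nat) \<Rightarrow> 'a agraph \<Rightarrow> form" where
  "permute_roots_graph \<sigma> g =
     (if \<sigma> permutes {..<length (roots g)} then basis (forest_of (permute_roots_of \<sigma> g)) else 0)"

lemma permute_roots_graph_relabel:
  assumes "aromatic g" "inj_on f (nodes g)"
  shows "permute_roots_graph \<sigma> (relabel f g) = permute_roots_graph \<sigma> g"
  using forest_of_permute_roots[OF assms] by (simp add: permute_roots_graph_def)

lift_definition permute_roots_forest :: "(nat \<Rightarrow> nat) \<Rightarrow> forest \<Rightarrow> form" is permute_roots_graph
  unfolding isomorphic_def using permute_roots_graph_relabel by metis

definition permute_roots :: "(nat \<Rightarrow> nat) \<Rightarrow> form \<Rightarrow> form" where
  "permute_roots \<sigma> = linear_ext (permute_roots_forest \<sigma>)"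

lemma permute_roots_forest_of:
  assumes g: "aromatic g" and \<sigma>: "\<sigma> permutes {..<length (roots g)}"
  shows "permute_roots \<sigma> (basis (forest_of g)) = basis (forest_of (permute_roots_of \<sigma> g))"
proof -
  obtain f where "inj_on f (nodes g)" "aromatic (relabel f g)"
    "forest_of g = abs_forest (relabel f g)" using forest_of_nat_graph[OF g] .
  then have "permute_roots_forest \<sigma> (forest_of g) = permute_roots_graph \<sigma> g"
    by (simp add: permute_roots_forest.abs_eq isomorphic_refl permute_roots_graph_relabel[OF g])
  then show ?thesis using \<sigma> by (simp add: permute_roots_def permute_roots_graph_def)
qed

lemma linear_permute_roots: "linear (permute_roots \<sigma>)"
  unfolding permute_roots_def by (rule linear_linear_ext)

lemma permute_roots_forms:
  assumes "\<sigma> permutes {..<n}" "x \<in> forms n p"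
  shows "permute_roots \<sigma> x \<in> forms n p"
proof (rule linear_forms[OF linear_permute_roots subspace_span _ assms(2)])
  fix \<gamma> assume "\<gamma> \<in> forests n p"
  then obtain g :: "nat agraph" where g: "aromatic g" "\<gamma> = forest_of g" "length (roots g) = n"
    "length (covertices g) = p" by (rule forests_cases)
  then have "aromatic (permute_roots_of \<sigma> g)" using aromatic_permute_roots assms(1) by blast
  then show "permute_roots \<sigma> (basis \<gamma>) \<in> forms n p"
    using forest_of_in_forests[of "permute_roots_of \<sigma> g"] g assms(1)
    by (simp add: permute_roots_forest_of basis_in_forms)
qed

text \<open>
  Permuting positions is a right action, hence the reversed order of composition.
\<close>

lemma permute_roots_compose:
  assumes "\<rho> permutes {..<n}" "\<sigma> permutes {..<n}" "x \<in> forms n p"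
  shows "permute_roots \<rho> (permute_roots \<sigma> x) = permute_roots (\<sigma> \<circ> \<rho>) x"
proof (rule linear_eq_on_forms[OF _ linear_permute_roots _ assms(3)])
  show "linear (\<lambda>x. permute_roots \<rho> (permute_roots \<sigma> x))"
    using linear_compose[OF linear_permute_roots linear_permute_roots, of \<rho> \<sigma>] by (simp add: comp_def)
  fix \<gamma> assume "\<gamma> \<in> forests n p"
  then obtain g :: "nat agraph" where g: "aromatic g" "\<gamma> = forest_of g" "length (roots g) = n"
    by (rule forests_cases)
  have "aromatic (permute_roots_of \<sigma> g)" using aromatic_permute_roots g assms by blast
  then show "permute_roots \<rho> (permute_roots \<sigma> (basis \<gamma>)) = permute_roots (\<sigma> \<circ> \<rho>) (basis \<gamma>)"
    using g assms permutes_compose[OF assms(1,2)]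
    by (simp add: permute_roots_forest_of permute_list_compose)
qed

lemma linear_wedge: "linear wedge"
  using linear_compose[OF linear_linear_ext linear_linear_ext]
  unfolding wedge_def wedge_roots_def wedge_covertices_def comp_def .

lemma wedge_roots_forms:
  assumes "x \<in> forms n p" shows "wedge_roots x \<in> forms n p"
  unfolding wedge_roots_def
proof (rule linear_forms[OF linear_linear_ext subspace_span _ assms])
  fix \<gamma> assume "\<gamma> \<in> forests n p"
  then obtain g :: "nat agraph" where g: "aromatic g" "\<gamma> = forest_of g" "length (roots g) = n"
    "length (covertices g) = p" by (rule forests_cases)
  have "basis (forest_of (permute_roots_of \<sigma> g)) \<in> forms n p" if "\<sigma> permutes {..<n}" for \<sigma>
    using forest_of_in_forests[OF aromatic_permute_roots[OF g(1)], of \<sigma>] that g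
    by (simp add: basis_in_forms)
  then have "wedge_roots_graph g \<in> forms n p"
    unfolding wedge_roots_graph_def Let_def g(3) by (intro span_scale span_sum) simp
  then show "linear_ext wedge_roots_forest (basis \<gamma>) \<in> forms n p"
    by (simp add: g(2) wedge_roots_forest_of[OF g(1)])
qed

lemma aromatic_permute_covertices:
  assumes g: "aromatic g" and \<sigma>: "\<sigma> permutes {..<length (covertices g)}"
  shows "aromatic (g\<lparr>covertices := permute_list \<sigma> (covertices g)\<rparr>)"
  using g unfolding aromatic_def by (simp add: \<sigma> nodes_def)

lemma wedge_covertices_forms:
  assumes "x \<in> forms n p" shows "wedge_covertices x \<in> forms n p"
  unfolding wedge_covertices_def
proof (rule linear_forms[OF linear_linear_ext subspace_span _ assms])
  fix \<gamma> assume "\<gamma> \<in> forests n p"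
  then obtain g :: "nat agraph" where g: "aromatic g" "\<gamma> = forest_of g" "length (roots g) = n"
    "length (covertices g) = p" by (rule forests_cases)
  have "basis (forest_of (g\<lparr>covertices := permute_list \<sigma> (covertices g)\<rparr>)) \<in> forms n p"
    if "\<sigma> permutes {..<p}" for \<sigma>
    using forest_of_in_forests[OF aromatic_permute_covertices[OF g(1)], of \<sigma>] that g
    by (simp add: basis_in_forms)
  then have "wedge_covertices_graph g \<in> forms n p"
    unfolding wedge_covertices_graph_def Let_def g(4) by (intro span_scale span_sum) simp
  then show "linear_ext wedge_covertices_forest (basis \<gamma>) \<in> forms n p"
    by (simp add: g(2) wedge_covertices_forest_of[OF g(1)])
qed

lemma Omega_subset_forms: "\<Omega> n p \<subseteq> forms n p"
  by (auto simp: \<Omega>_def wedge_def intro: wedge_roots_forms wedge_covertices_forms)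

definition alternating :: "nat \<Rightarrow> form \<Rightarrow> bool" where
  "alternating n x \<longleftrightarrow> (\<forall>\<sigma>. \<sigma> permutes {..<n} \<longrightarrow> permute_roots \<sigma> x = of_int (sign \<sigma>) *\<^sub>R x)"

text \<open>
  With at most one covertex only the roots are antisymmetrized.
\<close>

lemma wedge_eq_sum:
  assumes "p \<le> 1" "x \<in> forms n p"
  shows "wedge x = (1 / fact n) *\<^sub>R (\<Sum>\<sigma> | \<sigma> permutes {..<n}. of_int (sign \<sigma>) *\<^sub>R permute_roots \<sigma> x)"
proof (rule linear_eq_on_forms[OF _ _ _ assms(2)])
  show "linear wedge" by (rule linear_wedge)
  show "linear (\<lambda>x. (1 / fact n) *\<^sub>R (\<Sum>\<sigma> | \<sigma> permutes {..<n}. of_int (sign \<sigma>) *\<^sub>R permute_roots \<sigma> x))"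
    by (intro linear_compose_scale_right linear_compose_sum ballI linear_permute_roots)
  fix \<gamma> assume "\<gamma> \<in> forests n p"
  then obtain g :: "nat agraph" where g: "aromatic g" "\<gamma> = forest_of g" "length (roots g) = n"
    "length (covertices g) = p" by (rule forests_cases)
  have "{\<sigma>. \<sigma> permutes {..<p}} = {id}"
    using assms(1) by (cases "p = 0") (auto simp: le_Suc_eq lessThan_Suc permutes_sing)
  moreover have "fact p = (1 :: real)" using assms(1) by (cases "p = 0") (auto simp: le_Suc_eq)
  ultimately have "wedge_covertices (basis \<gamma>) = basis \<gamma>"
    using g by (simp add: wedge_covertices_def wedge_covertices_forest_of
        wedge_covertices_graph_def sign_id del: One_nat_def)
  then show "wedge (basis \<gamma>) = (1 / fact n) *\<^sub>R
      (\<Sum>\<sigma> | \<sigma> permutes {..<n}. of_int (sign \<sigma>) *\<^sub>R permute_roots \<sigma> (basis \<gamma>))"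
    using g by (simp add: wedge_def wedge_roots_def wedge_roots_forest_of wedge_roots_graph_def
        permute_roots_forest_of)
qed

lemma alternating_wedge:
  assumes "p \<le> 1" "x \<in> forms n p" shows "alternating n (wedge x)"
  unfolding alternating_def
proof (intro allI impI)
  fix \<rho> assume \<rho>: "\<rho> permutes {..<n}"
  have sgn: "of_int (sign \<sigma>) *\<^sub>R permute_roots (\<sigma> \<circ> \<rho>) x =
      of_int (sign \<rho>) *\<^sub>R of_int (sign (\<sigma> \<circ> \<rho>)) *\<^sub>R permute_roots (\<sigma> \<circ> \<rho>) x"
    if "\<sigma> \<in> {\<sigma>. \<sigma> permutes {..<n}}" for \<sigma>
  proof -
    have "sign \<sigma> = sign \<rho> * sign (\<sigma> \<circ> \<rho>)"
      using \<rho> that by (simp add: sign_compose permutes_imp_permutation[OF finite_lessThan])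
    then show ?thesis by simp
  qed
  have "permute_roots \<rho> (wedge x) = (1 / fact n) *\<^sub>R
      (\<Sum>\<sigma> | \<sigma> permutes {..<n}. of_int (sign \<sigma>) *\<^sub>R permute_roots (\<sigma> \<circ> \<rho>) x)"
    using permute_roots_compose[OF \<rho> _ assms(2)]
    by (simp add: wedge_eq_sum[OF assms] linear_scale[OF linear_permute_roots]
        linear_sum[OF linear_permute_roots])
  also have "\<dots> = (1 / fact n) *\<^sub>R
      (\<Sum>\<sigma> | \<sigma> permutes {..<n}.
        of_int (sign \<rho>) *\<^sub>R of_int (sign (\<sigma> \<circ> \<rho>)) *\<^sub>R permute_roots (\<sigma> \<circ> \<rho>) x)"
    by (intro arg_cong[where f = "scaleR (1 / fact n)"] sum.cong refl sgn) simp
  also have "\<dots> = (1 / fact n) *\<^sub>R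
      (\<Sum>\<sigma> | \<sigma> permutes {..<n}.
        of_int (sign \<rho>) *\<^sub>R of_int (sign \<sigma>) *\<^sub>R permute_roots \<sigma> x)"
    by (subst (2) sum_permutations_compose_right[OF \<rho>]) (rule refl)
  also have "\<dots> = of_int (sign \<rho>) *\<^sub>R wedge x"
    by (simp add: wedge_eq_sum[OF assms] scaleR_sum_right mult.commute)
  finally show "permute_roots \<rho> (wedge x) = of_int (sign \<rho>) *\<^sub>R wedge x" .
qed

lemma wedge_alternating:
  assumes "p \<le> 1" "x \<in> forms n p" "alternating n x" shows "wedge x = x"
proof -
  have "wedge x = (1 / fact n) *\<^sub>R (\<Sum>\<sigma> | \<sigma> permutes {..<n}. x)"
    unfolding wedge_eq_sum[OF assms(1,2)] using assms(3)
    by (intro arg_cong2[where f = scaleR] refl sum.cong)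
      (auto simp: alternating_def simp flip: of_int_mult)
  also have "\<dots> = x"
    by (simp add: card_permutations[of _ n] scaleR_conv_of_real sum_constant_scaleR)
  finally show ?thesis .
qed

text \<open>
  The wedge is the projection onto the forms on which the permutations of the roots act by their
  sign, so membership in its image becomes a condition on the form alone.
\<close>

lemma Omega_iff_alternating:
  assumes "p \<le> 1" shows "x \<in> \<Omega> n p \<longleftrightarrow> x \<in> forms n p \<and> alternating n x"
proof
  assume x: "x \<in> \<Omega> n p"
  then obtain y where "y \<in> forms n p" "x = wedge y" by (auto simp: \<Omega>_def)
  then show "x \<in> forms n p \<and> alternating n x"
    using alternating_wedge[OF assms] Omega_subset_forms x by blast
next
  assume "x \<in> forms n p \<and> alternating n x"
  then show "x \<in> \<Omega> n p"
    unfolding \<Omega>_def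
    by (intro image_eqI[of _ _ x]) (simp_all add: wedge_alternating[OF assms, of x n])
qed

lemma subspace_Omega: "subspace (\<Omega> n p)"
  unfolding \<Omega>_def by (rule linear_subspace_image[OF linear_wedge subspace_span])

text \<open>
  Only permutations of the first \<open>n'\<close> roots are required to commute with \<open>F\<close>; for the horizontal
  derivative, which consumes the last root, this is all that holds.
\<close>

lemma equivariant_Omega:
  assumes "p \<le> 1" "p' \<le> 1" "n' \<le> n" "linear F"
    and F: "\<And>\<gamma>. \<gamma> \<in> forests n p \<Longrightarrow> F (basis \<gamma>) \<in> forms n' p'"
    and eqv: "\<And>\<gamma> \<sigma>. \<gamma> \<in> forests n p \<Longrightarrow> \<sigma> permutes {..<n'} \<Longrightarrow>
      F (permute_roots \<sigma> (basis \<gamma>)) = permute_roots \<sigma> (F (basis \<gamma>))"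
    and x: "x \<in> \<Omega> n p"
  shows "F x \<in> \<Omega> n' p'"
proof -
  have xf: "x \<in> forms n p" and xa: "alternating n x"
    using x Omega_iff_alternating[OF assms(1)] by auto
  have "permute_roots \<sigma> (F x) = of_int (sign \<sigma>) *\<^sub>R F x" if \<sigma>: "\<sigma> permutes {..<n'}" for \<sigma>
  proof -
    have "permute_roots \<sigma> (F x) = F (permute_roots \<sigma> x)"
    proof (rule linear_eq_on_forms[OF _ _ _ xf])
      show "linear (\<lambda>y. permute_roots \<sigma> (F y))" "linear (\<lambda>y. F (permute_roots \<sigma> y))"
        using linear_compose[OF assms(4) linear_permute_roots]
          linear_compose[OF linear_permute_roots assms(4)] by (simp_all add: comp_def)
    qed (simp add: eqv \<sigma>)
    also have "\<sigma> permutes {..<n}" by (rule permutes_subset[OF \<sigma>]) (use assms(3) in simp)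
    then have "F (permute_roots \<sigma> x) = of_int (sign \<sigma>) *\<^sub>R F x"
      using xa by (simp add: alternating_def linear_scale[OF assms(4)])
    finally show ?thesis .
  qed
  moreover have "F x \<in> forms n' p'" by (rule linear_forms[OF assms(4) subspace_span F xf])
  ultimately show ?thesis by (simp add: Omega_iff_alternating[OF assms(2)] alternating_def)
qed

section \<open>The horizontal derivative\<close>

lemma linear_dH: "linear dH"
  unfolding dH_def by (rule linear_linear_ext)

lemma dH_basis: "aromatic g \<Longrightarrow> dH (basis (forest_of g)) = dH_graph g"
  by (simp add: dH_def dH_forest_of)

lemma nodes_add_edge [simp]: "nodes (add_edge r u g) = nodes g"
  by (simp add: nodes_def add_edge_def)

lemma dH_basis_forms:
  assumes "\<gamma> \<in> forests n p" shows "dH (basis \<gamma>) \<in> forms (n - 1) p"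
proof -
  obtain g :: "nat agraph" where g: "aromatic g" "\<gamma> = forest_of g" "length (roots g) = n"
    "length (covertices g) = p" using assms by (rule forests_cases)
  have "basis (forest_of (add_edge (last (roots g)) u g)) \<in> forms (n - 1) p"
    if "roots g \<noteq> []" "u \<in> nodes g" for u
    using forest_of_in_forests[OF aromatic_add_edge[OF g(1) last_in_set that(2)]] that g
    by (intro basis_in_forms) (simp add: add_edge_def length_remove1)
  then show ?thesis
    by (simp add: g(2) dH_basis[OF g(1)] dH_graph_def D_graph_def span_sum span_zero)
qed

lemma dH_forms_0: "x \<in> forms 0 p \<Longrightarrow> dH x = 0"
proof (rule linear_eq_on_forms[OF linear_dH linear_zero])
  fix \<gamma> assume "\<gamma> \<in> forests 0 p"
  then show "dH (basis \<gamma>) = 0" by (rule forests_cases) (simp add: dH_basis dH_graph_def)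
qed

lemma permute_list_append:
  assumes "\<sigma> permutes {..<length xs}"
  shows "permute_list \<sigma> (xs @ ys) = permute_list \<sigma> xs @ ys"
proof (rule nth_equalityI)
  have *: "\<sigma> permutes {..<length (xs @ ys)}" by (rule permutes_subset[OF assms]) simp
  fix i assume "i < length (permute_list \<sigma> (xs @ ys))"
  then show "permute_list \<sigma> (xs @ ys) ! i = (permute_list \<sigma> xs @ ys) ! i"
    using permutes_in_image[OF assms, of i] permutes_not_in[OF assms, of i]
    by (cases "i < length xs")
      (simp_all add: permute_list_nth[OF *] permute_list_nth[OF assms] nth_append)
qed simp

text \<open>
  A permutation that fixes the last position leaves unchanged the root from which the edge is added.
\<close>

lemma dH_permute_roots:
  assumes "\<gamma> \<in> forests n p" and \<sigma>: "\<sigma> permutes {..<n - 1}"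
  shows "dH (permute_roots \<sigma> (basis \<gamma>)) = permute_roots \<sigma> (dH (basis \<gamma>))"
proof -
  obtain g :: "nat agraph" where g: "aromatic g" "\<gamma> = forest_of g" "length (roots g) = n"
    using assms(1) by (rule forests_cases)
  have \<sigma>n: "\<sigma> permutes {..<length (roots g)}" by (rule permutes_subset[OF \<sigma>]) (auto simp: g(3))
  show ?thesis
  proof (cases "roots g" rule: rev_cases)
    case Nil
    then have \<gamma>: "basis \<gamma> \<in> forms 0 p" using assms(1) g(3) by (simp add: basis_in_forms)
    have "permute_roots \<sigma> (basis \<gamma>) \<in> forms 0 p"
      using permute_roots_forms[OF _ \<gamma>] \<sigma> g(3) Nil by simp
    then show ?thesis using dH_forms_0 \<gamma> linear_0[OF linear_permute_roots] by simp
  next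
    case (snoc rs r)
    then have "n - 1 = length rs" using g(3) by simp
    then have \<sigma>': "\<sigma> permutes {..<length rs}" using \<sigma> by simp
    have r: "r \<in> set (roots g)" "r \<notin> set rs" using snoc g(1) by (auto simp: aromatic_def)
    have "add_edge r u (permute_roots_of \<sigma> g) = permute_roots_of \<sigma> (add_edge r u g)" for u
      using \<sigma>' r(2) by (simp add: add_edge_def snoc permute_list_append remove1_append)
    moreover have "permute_roots \<sigma> (basis (forest_of (add_edge r u g))) =
        basis (forest_of (permute_roots_of \<sigma> (add_edge r u g)))" if "u \<in> nodes g" for u
      using \<sigma>' r(2)
      by (intro permute_roots_forest_of aromatic_add_edge[OF g(1) r(1) that])
        (simp add: add_edge_def snoc remove1_append)
    ultimately show ?thesis
      using \<sigma>n \<sigma>' g(1) snoc dH_basis[OF aromatic_permute_roots[OF g(1) \<sigma>n]]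
      by (simp add: g(2) permute_roots_forest_of dH_basis dH_graph_def
          D_graph_def permute_list_append linear_sum[OF linear_permute_roots])
  qed
qed

lemma dH_Omega: "p \<le> 1 \<Longrightarrow> x \<in> \<Omega> n p \<Longrightarrow> dH x \<in> \<Omega> (n - 1) p"
  by (rule equivariant_Omega[where F = dH and n = n and p = p and p' = p])
    (simp_all add: linear_dH dH_basis_forms dH_permute_roots del: One_nat_def)

text \<open>
  The right-hand side is symmetric in \<open>a\<close> and \<open>b\<close> up to the order of summation.
\<close>

lemma dH_dH_basis:
  assumes g: "aromatic g" and rs: "roots g = rs @ [a, b]"
  shows "dH (dH (basis (forest_of g))) = (\<Sum>u\<in>nodes g. \<Sum>w\<in>nodes g.
    basis (forest_of (g\<lparr>edges := {(a, w), (b, u)} \<union> edges g, roots := rs\<rparr>)))"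
proof -
  have d: "a \<noteq> b" "a \<notin> set rs" "b \<notin> set rs" using g rs by (auto simp: aromatic_def)
  have "dH (basis (forest_of (add_edge b u g))) = (\<Sum>w\<in>nodes g.
    basis (forest_of (g\<lparr>edges := {(a, w), (b, u)} \<union> edges g, roots := rs\<rparr>)))" if "u \<in> nodes g" for u
  proof -
    have "aromatic (add_edge b u g)" using aromatic_add_edge[OF g _ that, of b] rs by simp
    moreover have "roots (add_edge b u g) = rs @ [a]"
      using d rs by (simp add: add_edge_def remove1_append)
    ultimately have "dH (basis (forest_of (add_edge b u g))) =
        (\<Sum>w\<in>nodes g. basis (forest_of (add_edge a w (add_edge b u g))))"
      by (simp add: dH_basis dH_graph_def D_graph_def)
    moreover have "add_edge a w (add_edge b u g) =
        g\<lparr>edges := {(a, w), (b, u)} \<union> edges g, roots := rs\<rparr>" for w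
      using d rs by (simp add: add_edge_def remove1_append)
    ultimately show ?thesis by simp
  qed
  then show ?thesis
    by (simp add: dH_basis[OF g] rs dH_graph_def D_graph_def linear_sum[OF linear_dH])
qed

lemma permute_list_transpose_last:
  "permute_list (transpose (length xs) (Suc (length xs))) (xs @ [a, b]) = xs @ [b, a]"
proof (rule nth_equalityI)
  have *: "transpose (length xs) (Suc (length xs)) permutes {..<length (xs @ [a, b])}"
    by (rule permutes_swap_id) simp_all
  fix i assume "i < length (permute_list (transpose (length xs) (Suc (length xs))) (xs @ [a, b]))"
  then show "permute_list (transpose (length xs) (Suc (length xs))) (xs @ [a, b]) ! i = (xs @ [b, a]) ! i"
    by (auto simp: permute_list_nth[OF *] transpose_def nth_append less_Suc_eq nth_Cons')
qed simp

lemma dH_dH_Omega: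
  assumes "p \<le> 1" "x \<in> \<Omega> n p" shows "dH (dH x) = 0"
proof (cases "n < 2")
  case True
  then have "dH x \<in> forms 0 p"
    using dH_Omega[OF assms] Omega_iff_alternating[OF assms(1)] by (cases n) auto
  then show ?thesis by (rule dH_forms_0)
next
  case False
  define m where "m = n - 2"
  have m: "n = Suc (Suc m)" using False by (simp add: m_def)
  define \<sigma> where "\<sigma> = transpose m (Suc m)"
  have \<sigma>: "\<sigma> permutes {..<n}" unfolding \<sigma>_def by (rule permutes_swap_id) (simp_all add: m)
  have xf: "x \<in> forms n p" and xa: "alternating n x"
    using assms(2) Omega_iff_alternating[OF assms(1)] by auto
  have L: "linear (\<lambda>x. dH (dH x))" using linear_compose[OF linear_dH linear_dH] by (simp add: comp_def)
  have "dH (dH (permute_roots \<sigma> x)) = dH (dH x)"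
  proof (rule linear_eq_on_forms[OF _ L _ xf])
    show "linear (\<lambda>x. dH (dH (permute_roots \<sigma> x)))"
      using linear_compose[OF linear_permute_roots L] by (simp add: comp_def)
    fix \<gamma> assume "\<gamma> \<in> forests n p"
    then obtain g :: "nat agraph" where g: "aromatic g" "\<gamma> = forest_of g" "length (roots g) = n"
      by (rule forests_cases)
    obtain rs a b where rs: "roots g = rs @ [a, b]" "length rs = m"
    proof -
      obtain ys b where ys: "roots g = ys @ [b]" using g(3) m by (cases "roots g" rule: rev_cases) auto
      moreover obtain rs a where "ys = rs @ [a]" using g(3) m ys by (cases ys rule: rev_cases) auto
      ultimately show ?thesis using that g(3) m by auto
    qed
    have "permute_list \<sigma> (roots g) = rs @ [b, a]"
      using permute_list_transpose_last[of rs a b] by (simp add: rs \<sigma>_def)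
    moreover have "aromatic (permute_roots_of \<sigma> g)" using aromatic_permute_roots g \<sigma> by blast
    ultimately have "dH (dH (permute_roots \<sigma> (basis \<gamma>))) = (\<Sum>u\<in>nodes g. \<Sum>w\<in>nodes g.
        basis (forest_of (g\<lparr>edges := {(b, w), (a, u)} \<union> edges g, roots := rs\<rparr>)))"
      using g \<sigma> dH_dH_basis[of "permute_roots_of \<sigma> g" rs b a] by (simp add: permute_roots_forest_of)
    also have "\<dots> = dH (dH (basis \<gamma>))"
      unfolding g(2) dH_dH_basis[OF g(1) rs(1)]
      by (subst sum.swap) (simp add: insert_commute)
    finally show "dH (dH (permute_roots \<sigma> (basis \<gamma>))) = dH (dH (basis \<gamma>))" .
  qed
  \<comment> \<open>the transposition of the last two roots changes the sign of the alternating form \<open>x\<close>\<close>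
  moreover have "permute_roots \<sigma> x = - x"
    using xa \<sigma> by (simp add: alternating_def \<sigma>_def sign_swap_id)
  ultimately have "- dH (dH x) = dH (dH x)" using linear_neg[OF L] by metis
  then have "2 *\<^sub>R dH (dH x) = 0" by (metis scaleR_2 add.right_inverse)
  then show ?thesis by simp
qed

section \<open>The vertical derivative of forms without covertices\<close>

lemma nodes_to_covertex: "v \<in> vertices g \<Longrightarrow> nodes (to_covertex v g) = nodes g"
  by (auto simp: nodes_def to_covertex_def)

text \<open>The vertical derivative before taking the wedge.\<close>

definition verticals :: "form \<Rightarrow> form" where
  "verticals = linear_ext verticals_forest"

lemma linear_verticals: "linear verticals"
  unfolding verticals_def by (rule linear_linear_ext)

lemma verticals_basis: "aromatic g \<Longrightarrow> verticals (basis (forest_of g)) = verticals_graph g"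
  by (simp add: verticals_def verticals_forest_of)

lemma verticals_basis_forms:
  assumes "\<gamma> \<in> forests n p" shows "verticals (basis \<gamma>) \<in> forms n (Suc p)"
proof -
  obtain g :: "nat agraph" where g: "aromatic g" "\<gamma> = forest_of g" "length (roots g) = n"
    "length (covertices g) = p" using assms by (rule forests_cases)
  have "basis (forest_of (to_covertex v g)) \<in> forms n (Suc p)" if "v \<in> vertices g" for v
    using forest_of_in_forests[OF aromatic_to_covertex[OF g(1) that]] g
    by (intro basis_in_forms) (simp add: to_covertex_def)
  then show ?thesis by (simp add: g(2) verticals_basis[OF g(1)] verticals_graph_def span_sum)
qed

lemma verticals_permute_roots:
  assumes "\<gamma> \<in> forests n p" and \<sigma>: "\<sigma> permutes {..<n}"
  shows "verticals (permute_roots \<sigma> (basis \<gamma>)) = permute_roots \<sigma> (verticals (basis \<gamma>))"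
proof -
  obtain g :: "nat agraph" where g: "aromatic g" "\<gamma> = forest_of g" "length (roots g) = n"
    using assms(1) by (rule forests_cases)
  have "to_covertex v (permute_roots_of \<sigma> g) = permute_roots_of \<sigma> (to_covertex v g)" for v
    by (simp add: to_covertex_def)
  moreover have "permute_roots \<sigma> (basis (forest_of (to_covertex v g))) =
      basis (forest_of (permute_roots_of \<sigma> (to_covertex v g)))" if "v \<in> vertices g" for v
    using \<sigma> g by (intro permute_roots_forest_of aromatic_to_covertex[OF g(1) that])
      (simp add: to_covertex_def)
  ultimately show ?thesis
    using \<sigma> g by (simp add: permute_roots_forest_of verticals_basis aromatic_permute_roots
        verticals_graph_def linear_sum[OF linear_permute_roots])
qed

lemma verticals_Omega: "x \<in> \<Omega> n 0 \<Longrightarrow> verticals x \<in> \<Omega> n 1"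
  using verticals_basis_forms[of _ n 0]
  by (intro equivariant_Omega[where F = verticals and n = n and p = 0])
    (simp_all add: linear_verticals verticals_permute_roots)

text \<open>
  Turning vertices into a first covertex commutes with permutations of the roots, so the result is
  already alternating and the wedge in \<^const>\<open>dV\<close> acts as the identity.
\<close>

lemma dV_eq_verticals:
  assumes "x \<in> \<Omega> n 0" shows "dV x = verticals x"
proof -
  have "dV x = wedge (verticals x)"
    by (simp add: dV_def dV_forest_def[abs_def] verticals_def linear_apply_linear_ext[OF linear_wedge])
  then show ?thesis
    using wedge_alternating[of 1] verticals_Omega[OF assms] Omega_iff_alternating[of 1] by fastforce
qed

section \<open>Contraction\<close>

lemma linear_contraction: "linear (contraction \<tau>)"
  unfolding contraction_def linear_ext_def[of "\<lambda>t. linear_ext (contraction_forest t) _"]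
  by (intro linear_compose_sum ballI linear_compose_scale_right linear_linear_ext)

lemma contraction_basis:
  "contraction \<tau> (basis \<gamma>) = linear_ext (\<lambda>t. contraction_forest t \<gamma>) \<tau>"
  by (simp add: contraction_def)

lemma nodes_substitute:
  assumes "aromatic g" "k \<in> set (covertices g)" "covertices t = []"
  shows "nodes (substitute \<phi> t k g) = (nodes g - {k}) <+> nodes t"
  using assms by (auto simp: Plus_def nodes_def substitute_def Let_def aromatic_def set_remove1_eq)

lemma contraction_forms_0: "x \<in> forms n 0 \<Longrightarrow> contraction \<tau> x = 0"
proof (rule linear_eq_on_forms[OF linear_contraction linear_zero])
  fix \<gamma> assume "\<gamma> \<in> forests n 0"
  then obtain g :: "nat agraph" where g: "aromatic g" "\<gamma> = forest_of g" "covertices g = []"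
    by (rule forests_cases) simp
  have "contraction_forest t \<gamma> = 0" for t
  proof -
    obtain t' :: "nat agraph" where "aromatic t'" "t = forest_of t'" by (rule forest_cases)
    then show ?thesis using g by (simp add: contraction_forest_of contraction_graph_def)
  qed
  then show "contraction \<tau> (basis \<gamma>) = 0" by (simp add: contraction_basis linear_ext_def)
qed

lemma contraction_basis_forms:
  assumes "\<gamma> \<in> forests n (Suc p)" shows "contraction \<tau> (basis \<gamma>) \<in> forms n p"
proof -
  obtain g :: "nat agraph" where g: "aromatic g" "\<gamma> = forest_of g" "length (roots g) = n"
    "length (covertices g) = Suc p" using assms by (rule forests_cases)
  have "contraction_forest t \<gamma> \<in> forms n p" for t
  proof -
    obtain t' :: "nat agraph" where t: "aromatic t'" "t = forest_of t'" by (rule forest_cases)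
    let ?k = "last (covertices g)"
    have k: "?k \<in> set (covertices g)" using g(4) by (intro last_in_set) auto
    have "basis (forest_of (substitute \<phi> t' ?k g)) \<in> forms n p"
      if "length (roots t') = 1" "covertices t' = []" "\<phi> \<in> predecessors g ?k \<rightarrow>\<^sub>E nodes t'" for \<phi>
      using forest_of_in_forests[OF aromatic_substitute[OF g(1) k t(1) that]] g k
      by (intro basis_in_forms) (simp add: substitute_def Let_def length_remove1)
    then show ?thesis
      by (simp add: t g(2) contraction_forest_of[OF t(1) g(1)] contraction_graph_def
          substitution_graph_def span_zero span_scale span_sum)
  qed
  then show ?thesis by (simp add: contraction_basis linear_ext_in_subspace)
qed

text \<open>
  Substitution renames the roots but keeps their positions.
\<close>

lemma contraction_permute_roots:
  assumes "\<gamma> \<in> forests n p" and \<sigma>: "\<sigma> permutes {..<n}"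
  shows "contraction \<tau> (permute_roots \<sigma> (basis \<gamma>)) = permute_roots \<sigma> (contraction \<tau> (basis \<gamma>))"
proof -
  obtain g :: "nat agraph" where g: "aromatic g" "\<gamma> = forest_of g" "length (roots g) = n"
    using assms(1) by (rule forests_cases)
  let ?g = "permute_roots_of \<sigma> g"
  have ar: "aromatic ?g" using aromatic_permute_roots g \<sigma> by blast
  have "contraction_forest t (forest_of ?g) = permute_roots \<sigma> (contraction_forest t \<gamma>)" for t
  proof -
    obtain t' :: "nat agraph" where t: "aromatic t'" "t = forest_of t'" by (rule forest_cases)
    let ?k = "last (covertices g)"
    have "permute_roots \<sigma> (basis (forest_of (substitute \<phi> t' ?k g))) =
        basis (forest_of (substitute \<phi> t' ?k ?g))"
      if "length (roots t') = 1" "covertices t' = []" "covertices g \<noteq> []"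
        "\<phi> \<in> predecessors g ?k \<rightarrow>\<^sub>E nodes t'" for \<phi>
    proof -
      have k: "?k \<in> set (covertices g)" using that(3) by simp
      have "substitute \<phi> t' ?k ?g = permute_roots_of \<sigma> (substitute \<phi> t' ?k g)"
        using \<sigma> g(3) by (simp add: substitute_def Let_def permute_list_map)
      then show ?thesis
        using \<sigma> g(3) permute_roots_forest_of[OF aromatic_substitute[OF g(1) k t(1) that(1,2,4)], of \<sigma>]
        by (simp add: substitute_def Let_def)
    qed
    moreover have "predecessors ?g ?k = predecessors g ?k" by (simp add: predecessors_def)
    ultimately show ?thesis
      by (simp add: t g(2) contraction_forest_of[OF t(1)] g(1) ar contraction_graph_def
          substitution_graph_def linear_scale[OF linear_permute_roots]
          linear_sum[OF linear_permute_roots] linear_0[OF linear_permute_roots])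
  qed
  then show ?thesis
    using g \<sigma> by (simp add: permute_roots_forest_of contraction_basis
        linear_apply_linear_ext[OF linear_permute_roots])
qed

lemma contraction_Omega: "x \<in> \<Omega> n 1 \<Longrightarrow> contraction \<tau> x \<in> \<Omega> n 0"
  using contraction_basis_forms[of _ n 0]
  by (intro equivariant_Omega[where F = "contraction \<tau>" and n = n and p = 1])
    (simp_all add: linear_contraction contraction_permute_roots)

section \<open>Substituting a tree for a vertex commutes with the horizontal derivative\<close>

lemma sum_PiE_insert:
  assumes "r \<notin> A"
  shows "(\<Sum>\<phi>\<in>insert r A \<rightarrow>\<^sub>E B. f \<phi>) = (\<Sum>\<phi>\<in>A \<rightarrow>\<^sub>E B. \<Sum>x\<in>B. f (\<phi>(r := x)))"
proof -
  have "(\<Sum>\<phi>\<in>insert r A \<rightarrow>\<^sub>E B. f \<phi>) = (\<Sum>(x, \<phi>)\<in>B \<times> (A \<rightarrow>\<^sub>E B). f (\<phi>(r := x)))"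
    unfolding PiE_insert_eq by (subst sum.reindex[OF inj_combinator[OF assms]]) (simp add: case_prod_unfold)
  then show ?thesis by (simp flip: sum.cartesian_product add: sum.swap[of _ B])
qed

text \<open>
  The node of the substituted graph from which the outgoing edge of \<open>u\<close> now starts: the root of \<open>t\<close>
  inherits the edge, or the root number, of the covertex \<open>v\<close>.
\<close>

definition source_after :: "'b agraph \<Rightarrow> 'a \<Rightarrow> 'a \<Rightarrow> 'a + 'b" where
  "source_after t v u = (if u = v then Inr (hd (roots t)) else Inl u)"

lemma roots_substitute: "roots (substitute \<phi> t v g) = map (source_after t v) (roots g)"
  by (simp add: substitute_def source_after_def[abs_def])

lemma source_after_remove1:
  "map (source_after t v) (remove1 r rs) = remove1 (source_after t v r) (map (source_after t v) rs)"
  by (rule map_remove1_inj_on) (auto simp: inj_on_def source_after_def split: if_splits)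

text \<open>
  As long as the added edge does not end in \<open>v\<close>, the predecessors of \<open>v\<close> are the same before and
  after adding it, and the edge is carried along by the substitution.
\<close>

lemma substitute_add_edge_other:
  assumes "u \<noteq> v"
  shows "substitute \<phi> t v (to_covertex v (add_edge r u g)) =
    add_edge (source_after t v r) (Inl u) (substitute \<phi> t v (to_covertex v g))"
  using assms source_after_remove1[of t v r "roots g"]
  by (simp add: substitute_def to_covertex_def add_edge_def source_after_def[abs_def])

text \<open>
  An edge from the root \<open>r\<close> to \<open>v\<close> makes \<open>r\<close> a new predecessor of \<open>v\<close>, and grafting it on the node \<open>x\<close>
  of \<open>t\<close> amounts to adding the edge to \<open>x\<close> after the substitution. No other edge notices the changed
  value of \<open>\<phi>\<close>, because \<open>r\<close> had no outgoing edge. The case \<open>r = v\<close>, where the added edge is a loop, is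
  included.
\<close>

lemma substitute_add_edge_same:
  assumes "\<And>w. (r, w) \<notin> edges g"
  shows "substitute (\<phi>(r := x)) t v (to_covertex v (add_edge r v g)) =
    add_edge (source_after t v r) (Inr x) (substitute \<phi> t v (to_covertex v g))"
proof -
  have "(\<lambda>(u, w). (source_after t v u, if w = v then Inr ((\<phi>(r := x)) u) else Inl w)) ` edges g =
      (\<lambda>(u, w). (source_after t v u, if w = v then Inr (\<phi> u) else Inl w)) ` edges g"
    using assms by (intro image_cong) auto
  then show ?thesis
    using source_after_remove1[of t v r "roots g"]
    by (simp add: substitute_def to_covertex_def add_edge_def source_after_def[abs_def])
qed

text \<open>
  The nodes of the substituted graph are the nodes of \<open>g\<close> other than \<open>v\<close> and the nodes of \<open>t\<close>; the two
  sums correspond to the two preceding lemmas.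
\<close>

lemma dH_substitute:
  assumes t: "aromatic t" "length (roots t) = 1" "covertices t = []"
    and g: "aromatic g" "roots g = rs @ [r]" and v: "v \<in> vertices g"
    and \<phi>: "\<phi> \<in> predecessors g v \<rightarrow>\<^sub>E nodes t"
  defines "s \<equiv> substitute \<phi> t v (to_covertex v g)"
  shows "dH (basis (forest_of s)) =
    (\<Sum>u\<in>nodes g - {v}. basis (forest_of (add_edge (source_after t v r) (Inl u) s))) +
    (\<Sum>x\<in>nodes t. basis (forest_of (add_edge (source_after t v r) (Inr x) s)))"
proof -
  let ?g = "to_covertex v g"
  have ag: "aromatic ?g" and vc: "v \<in> set (covertices ?g)"
    using aromatic_to_covertex[OF g(1) v] by (simp_all add: to_covertex_def)
  have "predecessors ?g v = predecessors g v" by (simp add: predecessors_def to_covertex_def)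
  then have "aromatic s" unfolding s_def using aromatic_substitute[OF ag vc t] \<phi> by simp
  moreover have "nodes s = (nodes g - {v}) <+> nodes t"
    unfolding s_def nodes_substitute[OF ag vc t(3)] nodes_to_covertex[OF v] ..
  moreover have "roots s = map (source_after t v) (rs @ [r])"
    by (simp add: s_def roots_substitute to_covertex_def g(2))
  ultimately show ?thesis
    using g(1) t(1) by (simp add: dH_basis dH_graph_def D_graph_def sum.Plus aromatic_finite)
qed

lemma contraction_verticals_basis:
  assumes t: "aromatic t" "length (roots t) = 1" "covertices t = []"
    and g: "aromatic g" "covertices g = []"
  shows "linear_ext (contraction_forest (forest_of t)) (verticals (basis (forest_of g))) =
    (\<Sum>v\<in>vertices g. \<Sum>\<phi>\<in>predecessors g v \<rightarrow>\<^sub>E nodes t.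
      basis (forest_of (substitute \<phi> t v (to_covertex v g))))"
proof -
  have "predecessors (to_covertex v g) v = predecessors g v"
    "covertices (to_covertex v g) = [v]" for v
    using g(2) by (simp_all add: predecessors_def to_covertex_def)
  then show ?thesis
    using t g by (simp add: verticals_basis verticals_graph_def linear_ext_sum contraction_forest_of
        aromatic_to_covertex contraction_graph_def substitution_graph_def)
qed

text \<open>
  The bijection behind the commutation. A term on the left is a target \<open>u\<close> of the new edge, a vertex
  \<open>v\<close> to be replaced and a grafting of the predecessors of \<open>v\<close>; for fixed \<open>v\<close> the terms with \<open>u \<noteq> v\<close>
  match the new edges to old nodes on the right, and those with \<open>u = v\<close> match the new edges to nodes of
  the tree. Both sides vanish when there is no root, or when \<open>\<tau>\<close> is not a tree without covertices.
\<close>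

lemma contraction_forest_verticals_dH:
  assumes \<gamma>: "\<gamma> \<in> forests n 0"
  shows "linear_ext (contraction_forest \<tau>) (verticals (dH (basis \<gamma>))) =
    dH (linear_ext (contraction_forest \<tau>) (verticals (basis \<gamma>)))"
proof -
  obtain g :: "nat agraph" where g: "aromatic g" "\<gamma> = forest_of g" "length (roots g) = n"
    "covertices g = []" using \<gamma> by (rule forests_cases) simp
  obtain t :: "nat agraph" where t: "aromatic t" "\<tau> = forest_of t" by (rule forest_cases)
  let ?C = "linear_ext (contraction_forest \<tau>)" and ?N = "nodes g"
  have vg: "vertices g = ?N" using g(4) by (simp add: nodes_def)
  show ?thesis
  proof (cases "roots g" rule: rev_cases)
    case Nil
    then have n: "n = 0" using g(3) by simp
    have "verticals (basis \<gamma>) \<in> forms 0 (Suc 0)" using verticals_basis_forms[OF \<gamma>] n by simp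
    moreover have "?C (basis \<delta>) \<in> forms 0 0" if "\<delta> \<in> forests 0 (Suc 0)" for \<delta>
      using contraction_basis_forms[OF that, of "basis \<tau>"] by (simp add: contraction_basis)
    ultimately have "?C (verticals (basis \<gamma>)) \<in> forms 0 0"
      using linear_forms[OF linear_linear_ext[of "contraction_forest \<tau>"] subspace_span] by blast
    moreover have "dH (basis \<gamma>) = 0" using dH_forms_0 basis_in_forms[OF \<gamma>] n by simp
    ultimately show ?thesis
      using dH_forms_0 by (simp add: linear_0[OF linear_verticals] linear_ext_0)
  next
    case (snoc rs r)
    then have r: "r \<in> set (roots g)" and noout: "\<And>w. (r, w) \<notin> edges g"
      using g(1) by (auto simp: aromatic_def)
    show ?thesis
    proof (cases "length (roots t) = 1 \<and> covertices t = []")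
      case False
      have "?C (basis \<delta>) = 0" for \<delta>
      proof -
        obtain d :: "nat agraph" where "aromatic d" "\<delta> = forest_of d" by (rule forest_cases)
        then show ?thesis using t False by (auto simp: contraction_forest_of contraction_graph_def)
      qed
      then have "?C x = 0" for x by (simp add: linear_ext_def)
      then show ?thesis by (simp add: linear_0[OF linear_dH])
    next
      case True
      define src where "src v = (source_after t v r :: nat + nat)" for v
      define S where "S v \<phi> = substitute \<phi> t v (to_covertex v g)" for v \<phi>
      let ?Phi = "\<lambda>v. predecessors g v \<rightarrow>\<^sub>E nodes t"
      have fin: "finite ?N" using g(1) by (rule aromatic_finite)
      have C: "?C (verticals (basis (forest_of g'))) =
          (\<Sum>v\<in>?N. \<Sum>\<phi>\<in>predecessors g' v \<rightarrow>\<^sub>E nodes t.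
            basis (forest_of (substitute \<phi> t v (to_covertex v g'))))"
        if "aromatic g'" "covertices g' = []" "vertices g' = ?N" for g' :: "nat agraph"
        using contraction_verticals_basis[of t g'] t True that by simp
      have S_dH: "dH (basis (forest_of (S v \<phi>))) =
          (\<Sum>u\<in>?N - {v}. basis (forest_of (add_edge (src v) (Inl u) (S v \<phi>)))) +
          (\<Sum>x\<in>nodes t. basis (forest_of (add_edge (src v) (Inr x) (S v \<phi>))))"
        if "v \<in> ?N" "\<phi> \<in> ?Phi v" for v \<phi>
        unfolding S_def src_def using dH_substitute[OF t(1) _ _ g(1) snoc _ that(2)] that(1) True vg by simp
      have "?C (verticals (dH (basis \<gamma>))) =
          (\<Sum>u\<in>?N. ?C (verticals (basis (forest_of (add_edge r u g)))))"
        using snoc by (simp add: g(2) dH_basis[OF g(1)] dH_graph_def D_graph_def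
            linear_sum[OF linear_verticals] linear_ext_sum)
      also have "\<dots> = (\<Sum>u\<in>?N. \<Sum>v\<in>?N. \<Sum>\<phi>\<in>predecessors (add_edge r u g) v \<rightarrow>\<^sub>E nodes t.
            basis (forest_of (substitute \<phi> t v (to_covertex v (add_edge r u g)))))"
        using g(4) vg by (intro sum.cong refl C aromatic_add_edge[OF g(1) r]) (simp_all add: add_edge_def)
      also have "\<dots> = (\<Sum>v\<in>?N. \<Sum>u\<in>?N. \<Sum>\<phi>\<in>predecessors (add_edge r u g) v \<rightarrow>\<^sub>E nodes t.
            basis (forest_of (substitute \<phi> t v (to_covertex v (add_edge r u g)))))"
        by (rule sum.swap)
      also have "\<dots> = (\<Sum>v\<in>?N. \<Sum>\<phi>\<in>?Phi v. dH (basis (forest_of (S v \<phi>))))"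
      proof (rule sum.cong[OF refl])
        fix v assume v: "v \<in> ?N"
        let ?f = "\<lambda>u. \<Sum>\<phi>\<in>predecessors (add_edge r u g) v \<rightarrow>\<^sub>E nodes t.
            basis (forest_of (substitute \<phi> t v (to_covertex v (add_edge r u g))))"
        have other: "?f u = (\<Sum>\<phi>\<in>?Phi v. basis (forest_of (add_edge (src v) (Inl u) (S v \<phi>))))"
          if "u \<in> ?N - {v}" for u
        proof -
          have "predecessors (add_edge r u g) v = predecessors g v"
            using that by (auto simp: predecessors_def add_edge_def)
          moreover have "substitute \<phi> t v (to_covertex v (add_edge r u g)) =
              add_edge (src v) (Inl u) (S v \<phi>)" for \<phi>
            unfolding src_def S_def by (rule substitute_add_edge_other) (use that in simp)
          ultimately show ?thesis by simp
        qed
        have same: "?f v = (\<Sum>\<phi>\<in>?Phi v. \<Sum>x\<in>nodes t.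
            basis (forest_of (add_edge (src v) (Inr x) (S v \<phi>))))"
        proof -
          have "predecessors (add_edge r v g) v = insert r (predecessors g v)"
            by (auto simp: predecessors_def add_edge_def)
          moreover have "r \<notin> predecessors g v" using noout by (simp add: predecessors_def)
          moreover have "substitute (\<phi>(r := x)) t v (to_covertex v (add_edge r v g)) =
              add_edge (src v) (Inr x) (S v \<phi>)" for \<phi> x
            unfolding src_def S_def by (rule substitute_add_edge_same[OF noout])
          ultimately show ?thesis by (simp add: sum_PiE_insert)
        qed
        have "(\<Sum>u\<in>?N. ?f u) = (\<Sum>u\<in>?N - {v}. ?f u) + ?f v"
          using sum.remove[OF fin v, of ?f] by (simp add: add.commute)
        also have "\<dots> = (\<Sum>\<phi>\<in>?Phi v. dH (basis (forest_of (S v \<phi>))))"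
        proof -
          have "(\<Sum>u\<in>?N - {v}. ?f u) = (\<Sum>u\<in>?N - {v}. \<Sum>\<phi>\<in>?Phi v.
              basis (forest_of (add_edge (src v) (Inl u) (S v \<phi>))))"
            by (rule sum.cong[OF refl other])
          also have "\<dots> = (\<Sum>\<phi>\<in>?Phi v. \<Sum>u\<in>?N - {v}.
              basis (forest_of (add_edge (src v) (Inl u) (S v \<phi>))))"
            by (rule sum.swap)
          finally show ?thesis using S_dH[OF v] by (simp add: same sum.distrib)
        qed
        finally show "(\<Sum>u\<in>?N. ?f u) = (\<Sum>\<phi>\<in>?Phi v. dH (basis (forest_of (S v \<phi>))))" .
      qed
      also have "\<dots> = dH (?C (verticals (basis \<gamma>)))"
        using C[OF g(1,4) vg] by (simp add: g(2) linear_sum[OF linear_dH] S_def)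
      finally show ?thesis .
    qed
  qed
qed

lemma contraction_verticals_dH:
  assumes x: "x \<in> forms n 0"
  shows "contraction \<tau> (verticals (dH x)) = dH (contraction \<tau> (verticals x))"
proof -
  have "linear_ext (contraction_forest t) (verticals (dH x)) =
      dH (linear_ext (contraction_forest t) (verticals x))" for t
  proof (rule linear_eq_on_forms[OF _ _ _ x])
    show "linear (\<lambda>x. linear_ext (contraction_forest t) (verticals (dH x)))"
      "linear (\<lambda>x. dH (linear_ext (contraction_forest t) (verticals x)))"
      using linear_compose[OF linear_compose[OF linear_dH linear_verticals]
          linear_linear_ext[of "contraction_forest t"]]
        linear_compose[OF linear_compose[OF linear_verticals linear_linear_ext[of "contraction_forest t"]]
          linear_dH]
      by (simp_all add: comp_def)
  qed (rule contraction_forest_verticals_dH)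
  then show ?thesis by (simp add: contraction_def linear_apply_linear_ext[OF linear_dH])
qed

section \<open>The Lie derivative\<close>

text \<open>
  Of the four terms of the Lie derivative, those in which contraction meets a form without covertex
  vanish.
\<close>

lemma Lie_eq:
  assumes x: "x \<in> \<Omega> n 0" shows "Lie \<tau> x = contraction \<tau> (verticals x)"
proof -
  have xf: "x \<in> forms n 0" using x Omega_iff_alternating[of 0] by auto
  have dV: "linear dV" unfolding dV_def by (rule linear_linear_ext)
  have d: "linear d_total" unfolding d_total_def by (rule linear_linear_ext)
  have "d_total x = (-1) ^ n *\<^sub>R dH x + dV x"
  proof (rule linear_eq_on_forms[OF d _ _ xf])
    show "linear (\<lambda>x. (-1) ^ n *\<^sub>R dH x + dV x)"
      by (intro linear_compose_add linear_compose_scale_right linear_dH dV)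
  qed (simp add: d_total_def dH_def dV_def forests_def)
  moreover have "contraction \<tau> (dH x) = 0"
    using linear_forms[OF linear_dH subspace_span dH_basis_forms xf] by (rule contraction_forms_0)
  moreover have "contraction \<tau> x = 0" by (rule contraction_forms_0[OF xf])
  ultimately show ?thesis
    using dV_eq_verticals[OF x] linear_0[OF d]
    by (simp add: Lie_def linear_add[OF linear_contraction] linear_scale[OF linear_contraction])
qed

lemma Lie_Omega: "x \<in> \<Omega> n 0 \<Longrightarrow> Lie \<tau> x \<in> \<Omega> n 0"
  by (simp add: Lie_eq contraction_Omega verticals_Omega del: One_nat_def)

lemma Lie_dH:
  assumes "x \<in> \<Omega> n 0" shows "Lie \<tau> (dH x) = dH (Lie \<tau> x)"
  using assms dH_Omega[of 0 x n] contraction_verticals_dH[of x n] Omega_iff_alternating[of 0 x n]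
  by (simp add: Lie_eq)

lemma Lie_add:
  assumes "x \<in> \<Omega> n 0" "y \<in> \<Omega> n 0" shows "Lie \<tau> (x + y) = Lie \<tau> x + Lie \<tau> y"
  using assms subspace_add[OF subspace_Omega assms]
  by (simp add: Lie_eq linear_add[OF linear_verticals] linear_add[OF linear_contraction])

text \<open>
  The Lie derivative of \<open>x\<close> has \<open>n\<close> roots and no covertex, so unless it vanishes it can only be the
  horizontal derivative of a form with \<open>n + 1\<close> roots and no covertex; if it vanishes, 0 serves.
\<close>

lemma divergence_symmetry_iff:
  assumes x: "x \<in> \<Omega> n 0" and \<tau>: "\<tau> \<in> \<Omega> 1 0"
  shows "divergence_symmetry \<tau> x \<longleftrightarrow> Lie \<tau> x \<in> dH ` \<Omega> (Suc n) 0"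
proof
  assume "divergence_symmetry \<tau> x"
  then obtain m q \<eta> where \<eta>: "\<eta> \<in> \<Omega> m q" "Lie \<tau> x = dH \<eta>" by (auto simp: divergence_symmetry_def)
  show "Lie \<tau> x \<in> dH ` \<Omega> (Suc n) 0"
  proof (cases "dH \<eta> = 0")
    case True
    have "0 \<in> \<Omega> (Suc n) 0" by (rule subspace_0[OF subspace_Omega])
    then show ?thesis using \<eta>(2) True linear_0[OF linear_dH] by force
  next
    case False
    have \<eta>f: "\<eta> \<in> forms m q" using \<eta>(1) Omega_subset_forms by blast
    then have "m \<noteq> 0" using dH_forms_0[of \<eta> q] False by (cases m) auto
    moreover have "dH \<eta> \<in> forms (m - 1) q"
      by (rule linear_forms[OF linear_dH subspace_span dH_basis_forms \<eta>f])
    moreover have "dH \<eta> \<in> forms n 0" using Lie_Omega[OF x, of \<tau>] \<eta>(2) Omega_subset_forms by auto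
    ultimately have "m = Suc n \<and> q = 0" using forms_disjoint[of "dH \<eta>" "m - 1" q n 0] False by auto
    then show ?thesis using \<eta> by auto
  qed
next
  assume "Lie \<tau> x \<in> dH ` \<Omega> (Suc n) 0"
  then show "divergence_symmetry \<tau> x" using \<tau> by (auto simp: divergence_symmetry_def)
qed

section \<open>Divergence symmetries of solenoidal forms\<close>

theorem theorem3p17:
  fixes \<gamma>' \<gamma> :: form
  assumes "\<gamma>' \<in> \<Omega> 2 0" and "\<gamma> = dH \<gamma>'"
  shows "(\<forall>\<tau>\<in>\<Omega> 1 0. divergence_symmetry \<tau> \<gamma> \<and> Lie \<tau> \<gamma> \<in> dH ` \<Omega> 2 0) \<and>
         (\<forall>\<tau>\<in>\<Omega> 1 0.
            (divergence_symmetry \<tau> \<gamma>' \<longleftrightarrow> Lie \<tau> \<gamma>' \<in> dH ` \<Omega> 3 0) \<and>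
            (divergence_symmetry \<tau> \<gamma>' \<longrightarrow> symmetry \<tau> \<gamma>) \<and>
            (\<forall>h. homotopy_operators h \<longrightarrow>
               (divergence_symmetry \<tau> \<gamma>' \<longleftrightarrow> (\<exists>\<eta>\<in>\<Omega> 3 0. Lie_homotopy h 1 0 \<tau> \<gamma> = dH \<eta>))))"
proof (intro conjI ballI allI impI)
  fix \<tau> assume \<tau>: "\<tau> \<in> \<Omega> 1 0"
  have Lie_\<gamma>: "Lie \<tau> \<gamma> = dH (Lie \<tau> \<gamma>')" using Lie_dH assms by simp
  show "Lie \<tau> \<gamma> \<in> dH ` \<Omega> 2 0" using Lie_\<gamma> Lie_Omega[OF assms(1)] by simp
  then show "divergence_symmetry \<tau> \<gamma>" using \<tau> by (auto simp: divergence_symmetry_def)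
  show iff: "divergence_symmetry \<tau> \<gamma>' \<longleftrightarrow> Lie \<tau> \<gamma>' \<in> dH ` \<Omega> 3 0"
    using divergence_symmetry_iff[OF assms(1) \<tau>] by (simp add: eval_nat_numeral)
  show "symmetry \<tau> \<gamma>" if "divergence_symmetry \<tau> \<gamma>'"
    using that Lie_\<gamma> \<tau> dH_dH_Omega[of 0 _ 3] by (auto simp: iff symmetry_def)
  fix h assume h: "homotopy_operators h"
  have \<gamma>1: "\<gamma> \<in> \<Omega> 1 0" using dH_Omega[of 0 \<gamma>' 2] assms by simp
  have "h n 0 x \<in> \<Omega> (n + 1) 0" if "x \<in> \<Omega> n 0" for n x
    using h that unfolding homotopy_operators_def by blast
  from this[OF assms(1)] this[OF \<gamma>1] have \<zeta>: "h 2 0 \<gamma>' \<in> \<Omega> 3 0" and \<kappa>: "h 1 0 \<gamma> \<in> \<Omega> 2 0"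
    by (simp_all add: eval_nat_numeral)
  have "\<forall>n\<ge>1. \<forall>p. \<forall>x\<in>\<Omega> n p. x = dH (h n p x) + h (n - 1) p (dH x)"
    using h unfolding homotopy_operators_def by blast
  from this[rule_format, OF _ assms(1)] have "\<gamma>' = dH (h 2 0 \<gamma>') + h 1 0 \<gamma>"
    by (simp add: assms(2))
  moreover have "dH (h 2 0 \<gamma>') \<in> \<Omega> 2 0" using dH_Omega[OF _ \<zeta>] by simp
  ultimately have eq: "Lie \<tau> \<gamma>' = dH (Lie \<tau> (h 2 0 \<gamma>')) + Lie_homotopy h 1 0 \<tau> \<gamma>"
    using Lie_add[OF _ \<kappa>] Lie_dH[OF \<zeta>] by (metis Lie_homotopy_def)
  have W: "subspace (dH ` \<Omega> 3 0)" by (rule linear_subspace_image[OF linear_dH subspace_Omega])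
  have "dH (Lie \<tau> (h 2 0 \<gamma>')) \<in> dH ` \<Omega> 3 0" using Lie_Omega[OF \<zeta>] by blast
  then have "Lie \<tau> \<gamma>' \<in> dH ` \<Omega> 3 0 \<longleftrightarrow> Lie_homotopy h 1 0 \<tau> \<gamma> \<in> dH ` \<Omega> 3 0"
    unfolding eq using subspace_add[OF W] subspace_diff[OF W] by (metis add_diff_cancel_left')
  then show "divergence_symmetry \<tau> \<gamma>' \<longleftrightarrow> (\<exists>\<eta>\<in>\<Omega> 3 0. Lie_homotopy h 1 0 \<tau> \<gamma> = dH \<eta>)"
    unfolding iff by (auto simp: image_iff)
qed

end
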